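(* For any twin cotorsion pair $(\mathcal{S},\mathcal{T}),(\mathcal{U},\mathcal{V})$ on a triangulated category $\mathscr{C}$, the category $\underline{\mathcal{H}}=\mathcal{H}/\mathcal{W}$ is semi-abelian.
   Context: $\mathscr{C}$ is a triangulated category with shift $[1]$; all subcategories are full, additive, and closed under isomorphisms and direct summands. Write $\mathrm{Ext}^1(X,Y)=\mathscr{C}(X,Y[1])$, and $\mathrm{Ext}^1(\mathcal{M},\mathcal{N})=0$ means $\mathrm{Ext}^1(M,N)=0$ for all $M\in\mathcal{M},N\in\mathcal{N}$. $\mathcal{M}\ast\mathcal{N}$ is the full subcategory of objects $C$ admitting a distinguished triangle $M\to C\to N\to M[1]$ with $M\in\mathcal{M}$, $N\in\mathcal{N}$. A cotorsion pair $(\mathcal{U},\mathcal{V})$: $\mathrm{Ext}^1(\mathcal{U},\mathcal{V})=0$ and $\mathscr{C}=\mathcal{U}\ast\mathcal{V}[1]$. A twin cotorsion pair is a pair of cotorsion pairs $(\mathcal{S},\mathcal{T}),(\mathcal{U},\mathcal{V})$ with $\mathrm{Ext}^1(\mathcal{S},\mathcal{V})=0$. Put $\mathcal{W}=\mathcal{T}\cap\mathcal{U}$, $\mathscr{C}^-=\mathcal{S}[-1]\ast\mathcal{W}$, $\mathscr{C}^+=\mathcal{W}\ast\mathcal{V}[1]$, $\mathcal{H}=\mathscr{C}^+\cap\mathscr{C}^-$; $\underline{\mathcal{H}}$ is the ideal quotient of $\mathcal{H}$ by morphisms factoring through objects of $\mathcal{W}$. A preabelian category is an additive category where every morphism has a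 kernel and a cokernel. It is left semi-abelian if in every pullback square with top arrow $\alpha\colon A\to B$ and bottom arrow $\delta\colon C\to D$ (and vertical arrows $A\to C$, $B\to D$), $\delta$ being a cokernel morphism implies $\alpha$ is epimorphic; right semi-abelian is the dual notion (pushouts, kernel morphisms, monomorphisms); semi-abelian means preabelian, left and right semi-abelian. *)

theory Defs
  imports Main
begin

record ('o,'m) addcat =
  obj :: "'o set"
  mor :: "'m set"
  dm  :: "'m \<Rightarrow> 'o"
  cd  :: "'m \<Rightarrow> 'o"
  idm :: "'o \<Rightarrow> 'm"
  cmp :: "'m \<Rightarrow> 'm \<Rightarrow> 'm"   (* cmp C g f = g \<circ> f *)
  zr  :: "'o \<Rightarrow> 'o \<Rightarrow> 'm"
  ad  :: "'m \<Rightarrow> 'm \<Rightarrow> 'm"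
  ng  :: "'m \<Rightarrow> 'm"

definition Hom :: "('o,'m,'z) addcat_scheme \<Rightarrow> 'o \<Rightarrow> 'o \<Rightarrow> 'm set" where
  "Hom C X Y = {f \<in> mor C. dm C f = X \<and> cd C f = Y}"

definition category :: "('o,'m,'z) addcat_scheme \<Rightarrow> bool" where
  "category C \<longleftrightarrow>
     (\<forall>f\<in>mor C. dm C f \<in> obj C \<and> cd C f \<in> obj C) \<and>
     (\<forall>X\<in>obj C. idm C X \<in> Hom C X X) \<and>
     (\<forall>f g. f \<in> mor C \<and> g \<in> mor C \<and> cd C f = dm C g \<longrightarrow> cmp C g f \<in> Hom C (dm C f) (cd C g)) \<and>
     (\<forall>f g h. f \<in> mor C \<and> g \<in> mor C \<and> h \<in> mor C \<and> cd C f = dm C g \<and> cd C g = dm C h \<longrightarrow>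
        cmp C h (cmp C g f) = cmp C (cmp C h g) f) \<and>
     (\<forall>f\<in>mor C. cmp C f (idm C (dm C f)) = f \<and> cmp C (idm C (cd C f)) f = f)"

definition preadditive :: "('o,'m,'z) addcat_scheme \<Rightarrow> bool" where
  "preadditive C \<longleftrightarrow> category C \<and>
     (\<forall>X\<in>obj C. \<forall>Y\<in>obj C.
        zr C X Y \<in> Hom C X Y \<and>
        (\<forall>f\<in>Hom C X Y. \<forall>g\<in>Hom C X Y. ad C f g \<in> Hom C X Y) \<and>
        (\<forall>f\<in>Hom C X Y. ng C f \<in> Hom C X Y) \<and>
        (\<forall>f\<in>Hom C X Y. \<forall>g\<in>Hom C X Y. \<forall>h\<in>Hom C X Y. ad C (ad C f g) h = ad C f (ad C g h)) \<and>
        (\<forall>f\<in>Hom C X Y. \<forall>g\<in>Hom C X Y. ad C f g = ad C g f) \<and>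
        (\<forall>f\<in>Hom C X Y. ad C f (zr C X Y) = f) \<and>
        (\<forall>f\<in>Hom C X Y. ad C f (ng C f) = zr C X Y)) \<and>
     (\<forall>f g h. f \<in> mor C \<and> g \<in> mor C \<and> h \<in> mor C \<and> dm C g = dm C h \<and> cd C g = cd C h \<and> cd C f = dm C g
        \<longrightarrow> cmp C (ad C g h) f = ad C (cmp C g f) (cmp C h f)) \<and>
     (\<forall>f g h. f \<in> mor C \<and> g \<in> mor C \<and> h \<in> mor C \<and> dm C f = dm C g \<and> cd C f = cd C g \<and> cd C f = dm C h
        \<longrightarrow> cmp C h (ad C f g) = ad C (cmp C h f) (cmp C h g))"

definition zero_obj :: "('o,'m,'z) addcat_scheme \<Rightarrow> 'o \<Rightarrow> bool" where
  "zero_obj C Z \<longleftrightarrow> Z \<in> obj C \<and> idm C Z = zr C Z Z"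

definition is_biprod :: "('o,'m,'z) addcat_scheme \<Rightarrow> 'o \<Rightarrow> 'o \<Rightarrow> 'o \<Rightarrow> bool" where
  "is_biprod C X Y B \<longleftrightarrow> B \<in> obj C \<and>
     (\<exists>i1 i2 p1 p2. i1 \<in> Hom C X B \<and> i2 \<in> Hom C Y B \<and> p1 \<in> Hom C B X \<and> p2 \<in> Hom C B Y \<and>
        cmp C p1 i1 = idm C X \<and> cmp C p2 i2 = idm C Y \<and>
        cmp C p2 i1 = zr C X Y \<and> cmp C p1 i2 = zr C Y X \<and>
        ad C (cmp C i1 p1) (cmp C i2 p2) = idm C B)"

definition additive :: "('o,'m,'z) addcat_scheme \<Rightarrow> bool" where
  "additive C \<longleftrightarrow> preadditive C \<and> (\<exists>Z. zero_obj C Z) \<and>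
     (\<forall>X\<in>obj C. \<forall>Y\<in>obj C. \<exists>B. is_biprod C X Y B)"

definition iso :: "('o,'m,'z) addcat_scheme \<Rightarrow> 'm \<Rightarrow> bool" where
  "iso C f \<longleftrightarrow> f \<in> mor C \<and>
     (\<exists>g\<in>Hom C (cd C f) (dm C f). cmp C g f = idm C (dm C f) \<and> cmp C f g = idm C (cd C f))"

definition isomorphic :: "('o,'m,'z) addcat_scheme \<Rightarrow> 'o \<Rightarrow> 'o \<Rightarrow> bool" where
  "isomorphic C X Y \<longleftrightarrow> (\<exists>f\<in>Hom C X Y. iso C f)"

text \<open>sho / shm: the shift functor [1] on objects / morphisms; dtri: the distinguished
  triangles (f,g,h) standing for  X -f-> Y -g-> Z -h-> X[1].\<close>

record ('o,'m) tricat = "('o,'m) addcat" +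
  sho  :: "'o \<Rightarrow> 'o"
  shm  :: "'m \<Rightarrow> 'm"
  dtri :: "('m \<times> 'm \<times> 'm) set"

definition shift_autoequivalence :: "('o,'m,'z) tricat_scheme \<Rightarrow> bool" where
  "shift_autoequivalence C \<longleftrightarrow>
     (\<forall>X\<in>obj C. sho C X \<in> obj C) \<and>
     (\<forall>X Y. \<forall>f\<in>Hom C X Y. shm C f \<in> Hom C (sho C X) (sho C Y)) \<and>
     (\<forall>X\<in>obj C. shm C (idm C X) = idm C (sho C X)) \<and>
     (\<forall>f g. f \<in> mor C \<and> g \<in> mor C \<and> cd C f = dm C g \<longrightarrow> shm C (cmp C g f) = cmp C (shm C g) (shm C f)) \<and>
     (\<forall>f g. f \<in> mor C \<and> g \<in> mor C \<and> dm C f = dm C g \<and> cd C f = cd C g \<longrightarrow> shm C (ad C f g) = ad C (shm C f) (shm C g)) \<and>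
     (\<forall>X\<in>obj C. \<forall>Y\<in>obj C. inj_on (shm C) (Hom C X Y) \<and> shm C ` Hom C X Y = Hom C (sho C X) (sho C Y)) \<and>
     (\<forall>Y\<in>obj C. \<exists>X\<in>obj C. isomorphic C (sho C X) Y)"

definition pretriangle :: "('o,'m,'z) tricat_scheme \<Rightarrow> 'm \<Rightarrow> 'm \<Rightarrow> 'm \<Rightarrow> bool" where
  "pretriangle C f g h \<longleftrightarrow> f \<in> mor C \<and> g \<in> mor C \<and> h \<in> mor C \<and>
     cd C f = dm C g \<and> cd C g = dm C h \<and> cd C h = sho C (dm C f)"

definition triangulated :: "('o,'m,'z) tricat_scheme \<Rightarrow> bool" where
  "triangulated C \<longleftrightarrow> additive C \<and> shift_autoequivalence C \<and>
     \<comment> \<open>distinguished triangles are triangles\<close>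
     (\<forall>f g h. (f,g,h) \<in> dtri C \<longrightarrow> pretriangle C f g h) \<and>
     \<comment> \<open>TR1: closed under isomorphisms of triangles\<close>
     (\<forall>f g h f' g' h' a b c. (f,g,h) \<in> dtri C \<and> pretriangle C f' g' h' \<and>
        a \<in> Hom C (dm C f) (dm C f') \<and> b \<in> Hom C (cd C f) (cd C f') \<and> c \<in> Hom C (cd C g) (cd C g') \<and>
        iso C a \<and> iso C b \<and> iso C c \<and>
        cmp C f' a = cmp C b f \<and> cmp C g' b = cmp C c g \<and> cmp C h' c = cmp C (shm C a) h
        \<longrightarrow> (f',g',h') \<in> dtri C) \<and>
     \<comment> \<open>TR1: X -id-> X -> 0 -> X[1] is distinguished\<close>
     (\<forall>X\<in>obj C. \<exists>Z. zero_obj C Z \<and> (idm C X, zr C X Z, zr C Z (sho C X)) \<in> dtri C) \<and>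
     \<comment> \<open>TR1: every morphism embeds in a distinguished triangle\<close>
     (\<forall>f\<in>mor C. \<exists>g h. (f,g,h) \<in> dtri C) \<and>
     \<comment> \<open>TR2: rotation\<close>
     (\<forall>f g h. (f,g,h) \<in> dtri C \<longrightarrow> (g, h, ng C (shm C f)) \<in> dtri C) \<and>
     (\<forall>f g h. pretriangle C f g h \<and> (g, h, ng C (shm C f)) \<in> dtri C \<longrightarrow> (f,g,h) \<in> dtri C) \<and>
     \<comment> \<open>TR3: completion of morphisms of triangles\<close>
     (\<forall>f g h f' g' h' a b. (f,g,h) \<in> dtri C \<and> (f',g',h') \<in> dtri C \<and>
        a \<in> Hom C (dm C f) (dm C f') \<and> b \<in> Hom C (cd C f) (cd C f') \<and> cmp C b f = cmp C f' a
        \<longrightarrow> (\<exists>c\<in>Hom C (cd C g) (cd C g'). cmp C c g = cmp C g' b \<and> cmp C h' c = cmp C (shm C a) h)) \<and>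
     \<comment> \<open>TR4: octahedral axiom\<close>
     (\<forall>f f' f'' g g' g'' h' h''. (f,f',f'') \<in> dtri C \<and> (g,g',g'') \<in> dtri C \<and> cd C f = dm C g \<and>
        (cmp C g f, h', h'') \<in> dtri C
        \<longrightarrow> (\<exists>u v. u \<in> Hom C (cd C f') (cd C h') \<and> v \<in> Hom C (cd C h') (cd C g') \<and>
               (u, v, cmp C (shm C f') g'') \<in> dtri C \<and>
               cmp C u f' = cmp C h' g \<and> cmp C h'' u = f'' \<and>
               cmp C v h' = g' \<and> cmp C (shm C f) h'' = cmp C g'' v))"

text \<open>Full subcategories are given by their (iso-closed) object sets; standing assumption:
  additive and closed under isomorphisms and direct summands.\<close>

definition subcat :: "('o,'m,'z) addcat_scheme \<Rightarrow> 'o set \<Rightarrow> bool" where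
  "subcat C D \<longleftrightarrow> D \<subseteq> obj C \<and>
     (\<forall>X\<in>D. \<forall>Y. isomorphic C X Y \<longrightarrow> Y \<in> D) \<and>
     (\<exists>Z\<in>D. zero_obj C Z) \<and>
     (\<forall>X Y B. X \<in> D \<and> Y \<in> D \<and> is_biprod C X Y B \<longrightarrow> B \<in> D) \<and>
     (\<forall>X Y B. B \<in> D \<and> is_biprod C X Y B \<longrightarrow> X \<in> D \<and> Y \<in> D)"

definition ext1_zero :: "('o,'m,'z) tricat_scheme \<Rightarrow> 'o set \<Rightarrow> 'o set \<Rightarrow> bool" where
  "ext1_zero C M N \<longleftrightarrow> (\<forall>X\<in>M. \<forall>Y\<in>N. Hom C X (sho C Y) = {zr C X (sho C Y)})"

definition shift_up :: "('o,'m,'z) tricat_scheme \<Rightarrow> 'o set \<Rightarrow> 'o set" where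
  "shift_up C N = {Y \<in> obj C. \<exists>X\<in>N. isomorphic C (sho C X) Y}"

definition shift_down :: "('o,'m,'z) tricat_scheme \<Rightarrow> 'o set \<Rightarrow> 'o set" where
  "shift_down C N = {X \<in> obj C. sho C X \<in> N}"

definition star :: "('o,'m,'z) tricat_scheme \<Rightarrow> 'o set \<Rightarrow> 'o set \<Rightarrow> 'o set" where
  "star C M N = {Z \<in> obj C. \<exists>f g h. (f,g,h) \<in> dtri C \<and> dm C f \<in> M \<and> cd C f = Z \<and> cd C g \<in> N}"

definition cotorsion_pair :: "('o,'m,'z) tricat_scheme \<Rightarrow> 'o set \<Rightarrow> 'o set \<Rightarrow> bool" where
  "cotorsion_pair C U V \<longleftrightarrow> ext1_zero C U V \<and> obj C = star C U (shift_up C V)"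

definition twin_cotorsion_pair ::
  "('o,'m,'z) tricat_scheme \<Rightarrow> 'o set \<Rightarrow> 'o set \<Rightarrow> 'o set \<Rightarrow> 'o set \<Rightarrow> bool" where
  "twin_cotorsion_pair C S T U V \<longleftrightarrow>
     cotorsion_pair C S T \<and> cotorsion_pair C U V \<and> ext1_zero C S V"

definition Wcal :: "'o set \<Rightarrow> 'o set \<Rightarrow> 'o set" where
  "Wcal T U = T \<inter> U"

definition Cminus :: "('o,'m,'z) tricat_scheme \<Rightarrow> 'o set \<Rightarrow> 'o set \<Rightarrow> 'o set \<Rightarrow> 'o set" where
  "Cminus C S T U = star C (shift_down C S) (Wcal T U)"

definition Cplus :: "('o,'m,'z) tricat_scheme \<Rightarrow> 'o set \<Rightarrow> 'o set \<Rightarrow> 'o set \<Rightarrow> 'o set" where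
  "Cplus C T U V = star C (Wcal T U) (shift_up C V)"

definition Hcal :: "('o,'m,'z) tricat_scheme \<Rightarrow> 'o set \<Rightarrow> 'o set \<Rightarrow> 'o set \<Rightarrow> 'o set \<Rightarrow> 'o set" where
  "Hcal C S T U V = Cplus C T U V \<inter> Cminus C S T U"

definition factors_through :: "('o,'m,'z) addcat_scheme \<Rightarrow> 'o set \<Rightarrow> 'm \<Rightarrow> bool" where
  "factors_through C W h \<longleftrightarrow>
     (\<exists>X\<in>W. \<exists>a b. a \<in> Hom C (dm C h) X \<and> b \<in> Hom C X (cd C h) \<and> h = cmp C b a)"

definition cls :: "('o,'m,'z) addcat_scheme \<Rightarrow> 'o set \<Rightarrow> 'm \<Rightarrow> 'm set" where
  "cls C W f = {g \<in> Hom C (dm C f) (cd C f). factors_through C W (ad C g (ng C f))}"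

definition rep :: "'m set \<Rightarrow> 'm" where
  "rep A = (SOME f. f \<in> A)"

definition ideal_quotient :: "('o,'m,'z) addcat_scheme \<Rightarrow> 'o set \<Rightarrow> 'o set \<Rightarrow> ('o, 'm set) addcat" where
  "ideal_quotient C H W =
     \<lparr> obj = H,
       mor = {cls C W f | f. f \<in> mor C \<and> dm C f \<in> H \<and> cd C f \<in> H},
       dm = (\<lambda>A. dm C (rep A)),
       cd = (\<lambda>A. cd C (rep A)),
       idm = (\<lambda>X. cls C W (idm C X)),
       cmp = (\<lambda>B A. cls C W (cmp C (rep B) (rep A))),
       zr = (\<lambda>X Y. cls C W (zr C X Y)),
       ad = (\<lambda>A B. cls C W (ad C (rep A) (rep B))),
       ng = (\<lambda>A. cls C W (ng C (rep A))) \<rparr>"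

definition Hquot :: "('o,'m,'z) tricat_scheme \<Rightarrow> 'o set \<Rightarrow> 'o set \<Rightarrow> 'o set \<Rightarrow> 'o set \<Rightarrow> ('o, 'm set) addcat" where
  "Hquot C S T U V = ideal_quotient C (Hcal C S T U V) (Wcal T U)"

definition mono :: "('o,'m,'z) addcat_scheme \<Rightarrow> 'm \<Rightarrow> bool" where
  "mono C f \<longleftrightarrow> f \<in> mor C \<and>
     (\<forall>g h. g \<in> mor C \<and> h \<in> mor C \<and> cd C g = dm C f \<and> cd C h = dm C f \<and> dm C g = dm C h \<and>
        cmp C f g = cmp C f h \<longrightarrow> g = h)"

definition epi :: "('o,'m,'z) addcat_scheme \<Rightarrow> 'm \<Rightarrow> bool" where
  "epi C f \<longleftrightarrow> f \<in> mor C \<and>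
     (\<forall>g h. g \<in> mor C \<and> h \<in> mor C \<and> dm C g = cd C f \<and> dm C h = cd C f \<and> cd C g = cd C h \<and>
        cmp C g f = cmp C h f \<longrightarrow> g = h)"

definition is_kernel :: "('o,'m,'z) addcat_scheme \<Rightarrow> 'm \<Rightarrow> 'm \<Rightarrow> bool" where
  "is_kernel C f k \<longleftrightarrow> k \<in> mor C \<and> cd C k = dm C f \<and> cmp C f k = zr C (dm C k) (cd C f) \<and>
     (\<forall>g\<in>mor C. cd C g = dm C f \<and> cmp C f g = zr C (dm C g) (cd C f) \<longrightarrow>
        (\<exists>!u. u \<in> Hom C (dm C g) (dm C k) \<and> cmp C k u = g))"

definition is_cokernel :: "('o,'m,'z) addcat_scheme \<Rightarrow> 'm \<Rightarrow> 'm \<Rightarrow> bool" where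
  "is_cokernel C f c \<longleftrightarrow> c \<in> mor C \<and> dm C c = cd C f \<and> cmp C c f = zr C (dm C f) (cd C c) \<and>
     (\<forall>g\<in>mor C. dm C g = cd C f \<and> cmp C g f = zr C (dm C f) (cd C g) \<longrightarrow>
        (\<exists>!u. u \<in> Hom C (cd C c) (cd C g) \<and> cmp C u c = g))"

definition kernel_morphism :: "('o,'m,'z) addcat_scheme \<Rightarrow> 'm \<Rightarrow> bool" where
  "kernel_morphism C k \<longleftrightarrow> (\<exists>f\<in>mor C. is_kernel C f k)"

definition cokernel_morphism :: "('o,'m,'z) addcat_scheme \<Rightarrow> 'm \<Rightarrow> bool" where
  "cokernel_morphism C c \<longleftrightarrow> (\<exists>f\<in>mor C. is_cokernel C f c)"

definition preabelian :: "('o,'m,'z) addcat_scheme \<Rightarrow> bool" where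
  "preabelian C \<longleftrightarrow> additive C \<and>
     (\<forall>f\<in>mor C. (\<exists>k. is_kernel C f k) \<and> (\<exists>c. is_cokernel C f c))"

text \<open>Commutative square with top arrow \<alpha>: A \<rightarrow> B, bottom arrow \<delta>: C \<rightarrow> D,
  vertical arrows \<gamma>: A \<rightarrow> C and \<beta>: B \<rightarrow> D.\<close>

definition comm_square :: "('o,'m,'z) addcat_scheme \<Rightarrow> 'm \<Rightarrow> 'm \<Rightarrow> 'm \<Rightarrow> 'm \<Rightarrow> bool" where
  "comm_square C \<alpha> \<beta> \<gamma> \<delta> \<longleftrightarrow> \<alpha> \<in> mor C \<and> \<beta> \<in> mor C \<and> \<gamma> \<in> mor C \<and> \<delta> \<in> mor C \<and>
     dm C \<alpha> = dm C \<gamma> \<and> cd C \<alpha> = dm C \<beta> \<and> cd C \<gamma> = dm C \<delta> \<and> cd C \<beta> = cd C \<delta> \<and>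
     cmp C \<beta> \<alpha> = cmp C \<delta> \<gamma>"

definition pullback_square :: "('o,'m,'z) addcat_scheme \<Rightarrow> 'm \<Rightarrow> 'm \<Rightarrow> 'm \<Rightarrow> 'm \<Rightarrow> bool" where
  "pullback_square C \<alpha> \<beta> \<gamma> \<delta> \<longleftrightarrow> comm_square C \<alpha> \<beta> \<gamma> \<delta> \<and>
     (\<forall>x y. x \<in> mor C \<and> y \<in> mor C \<and> dm C x = dm C y \<and> cd C x = dm C \<beta> \<and> cd C y = dm C \<delta> \<and>
        cmp C \<beta> x = cmp C \<delta> y \<longrightarrow>
        (\<exists>!u. u \<in> Hom C (dm C x) (dm C \<alpha>) \<and> cmp C \<alpha> u = x \<and> cmp C \<gamma> u = y))"

definition pushout_square :: "('o,'m,'z) addcat_scheme \<Rightarrow> 'm \<Rightarrow> 'm \<Rightarrow> 'm \<Rightarrow> 'm \<Rightarrow> bool" where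
  "pushout_square C \<alpha> \<beta> \<gamma> \<delta> \<longleftrightarrow> comm_square C \<alpha> \<beta> \<gamma> \<delta> \<and>
     (\<forall>x y. x \<in> mor C \<and> y \<in> mor C \<and> cd C x = cd C y \<and> dm C x = cd C \<alpha> \<and> dm C y = cd C \<gamma> \<and>
        cmp C x \<alpha> = cmp C y \<gamma> \<longrightarrow>
        (\<exists>!u. u \<in> Hom C (cd C \<beta>) (cd C x) \<and> cmp C u \<beta> = x \<and> cmp C u \<delta> = y))"

definition left_semi_abelian :: "('o,'m,'z) addcat_scheme \<Rightarrow> bool" where
  "left_semi_abelian C \<longleftrightarrow>
     (\<forall>\<alpha> \<beta> \<gamma> \<delta>. pullback_square C \<alpha> \<beta> \<gamma> \<delta> \<and> cokernel_morphism C \<delta> \<longrightarrow> epi C \<alpha>)"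

definition right_semi_abelian :: "('o,'m,'z) addcat_scheme \<Rightarrow> bool" where
  "right_semi_abelian C \<longleftrightarrow>
     (\<forall>\<alpha> \<beta> \<gamma> \<delta>. pushout_square C \<alpha> \<beta> \<gamma> \<delta> \<and> kernel_morphism C \<alpha> \<longrightarrow> mono C \<delta>)"

definition semi_abelian :: "('o,'m,'z) addcat_scheme \<Rightarrow> bool" where
  "semi_abelian C \<longleftrightarrow> preabelian C \<and> left_semi_abelian C \<and> right_semi_abelian C"

end

(*
  Modulo W, a map out of an object X of C^- vanishes iff it vanishes on the S[-1]-part of X, and dually
  for maps into C^+.  Call m : X -> Y a deflation if it sits in a triangle S[-1] -> X -> Y -> S.
  Deflations are epimorphic modulo W with respect to targets in C^+; C^- is closed under both source
  and target of deflations; deflations can be pulled back; and every object of C^- has a reflection into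
  the heart that is a deflation.  The cokernel of f : A -> B is the reflection of the cone of
  S_A[-1] -> A -> B, hence a composite of two deflations; pulling these back along a map B' -> coker f
  and reflecting the result into the heart yields an epimorphism that factors through the top arrow of
  the pullback square, so the latter is epimorphic.

  Since the shift is only an autoequivalence, the opposite of a triangulated category is awkward to
  form.  All that the argument uses is recorded in the locale twin_pair, which mentions triangles
  without their third arrow and no shift, so that it is self-dual on the nose.
*)
theory Submission
  imports Defs
begin

section \<open>Preadditive categories\<close>

text \<open>The constructions leave the heart: the cone that serves as weak cokernel and the objects
  obtained by pulling back deflations are controlled on the \<open>Cm\<close> side only, and
  reflection restores \<open>Cp\<close>. Equations are therefore arranged strictly in
  \<open>C\<close> and read modulo W afterwards, where deflations cancel against targets in
  \<open>Cp\<close>. In the locale, \<open>T\<close> and \<open>U\<close> are given as orthogonals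
  (\<open>T_eq\<close>, \<open>U_eq\<close>), so membership becomes a vanishing test on maps;
  deriving these equalities from a cotorsion pair is where closure under direct summands enters. The
  condition Ext^1(S,V) = 0 enters as \<open>S_U\<close> and \<open>V_T\<close>. Of exactness the
  locale keeps weak kernels and cokernels, cones and cocones, two forms of the octahedron, and
  rotations of triangles with a corner in S or V. Deriving these from a shift that is fully faithful
  and essentially surjective, but has no strict inverse, occupies the last section.\<close>

locale preadd_cat =
  fixes C :: "('o,'m,'z) addcat_scheme"
  assumes preadd: "preadditive C"
begin

abbreviation comp (infixl "\<cdot>" 70) where "g \<cdot> f \<equiv> cmp C g f"
abbreviation plus (infixl "\<oplus>" 65) where "f \<oplus> g \<equiv> ad C f g"
abbreviation minus (infixl "\<ominus>" 65) where "f \<ominus> g \<equiv> ad C f (ng C g)"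

lemma HomD:
  assumes "f \<in> Hom C X Y"
  shows "f \<in> mor C" "dm C f = X" "cd C f = Y" "X \<in> obj C" "Y \<in> obj C"
  using assms preadd unfolding Hom_def preadditive_def category_def by auto

lemma mor_Hom: "f \<in> mor C \<Longrightarrow> f \<in> Hom C (dm C f) (cd C f)"
  by (simp add: Hom_def)

lemma mor_objs: "f \<in> mor C \<Longrightarrow> dm C f \<in> obj C" "f \<in> mor C \<Longrightarrow> cd C f \<in> obj C"
  using HomD mor_Hom by blast+

lemma comp_Hom [simp, intro]: "g \<in> Hom C Y Z \<Longrightarrow> f \<in> Hom C X Y \<Longrightarrow> g \<cdot> f \<in> Hom C X Z"
  using preadd unfolding Hom_def preadditive_def category_def by auto

lemma id_Hom [simp, intro]: "X \<in> obj C \<Longrightarrow> idm C X \<in> Hom C X X"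
  using preadd unfolding preadditive_def category_def by auto

lemma comp_assoc:
  "h \<in> Hom C Z Y' \<Longrightarrow> g \<in> Hom C Y Z \<Longrightarrow> f \<in> Hom C X Y \<Longrightarrow> h \<cdot> (g \<cdot> f) = h \<cdot> g \<cdot> f"
  using preadd unfolding Hom_def preadditive_def category_def by auto

lemma id_right [simp]: "f \<in> Hom C X Y \<Longrightarrow> f \<cdot> idm C X = f"
  and id_left [simp]: "f \<in> Hom C X Y \<Longrightarrow> idm C Y \<cdot> f = f"
  using preadd unfolding Hom_def preadditive_def category_def by auto

lemma zero_Hom [simp, intro]: "X \<in> obj C \<Longrightarrow> Y \<in> obj C \<Longrightarrow> zr C X Y \<in> Hom C X Y"
  using preadd unfolding preadditive_def by blast

lemma plus_Hom [simp, intro]: "f \<in> Hom C X Y \<Longrightarrow> g \<in> Hom C X Y \<Longrightarrow> f \<oplus> g \<in> Hom C X Y"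
  using preadd HomD(4,5)[of f X Y] unfolding preadditive_def by blast

lemma neg_Hom [simp, intro]: "f \<in> Hom C X Y \<Longrightarrow> ng C f \<in> Hom C X Y"
  using preadd HomD(4,5)[of f X Y] unfolding preadditive_def by blast

lemma plus_assoc:
  "f \<in> Hom C X Y \<Longrightarrow> g \<in> Hom C X Y \<Longrightarrow> h \<in> Hom C X Y \<Longrightarrow> f \<oplus> g \<oplus> h = f \<oplus> (g \<oplus> h)"
  using preadd HomD(4,5)[of f X Y] unfolding preadditive_def by blast

lemma plus_commute: "f \<in> Hom C X Y \<Longrightarrow> g \<in> Hom C X Y \<Longrightarrow> f \<oplus> g = g \<oplus> f"
  using preadd HomD(4,5)[of f X Y] unfolding preadditive_def by blast

lemma plus_zero [simp]: "f \<in> Hom C X Y \<Longrightarrow> f \<oplus> zr C X Y = f"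
  using preadd HomD(4,5)[of f X Y] unfolding preadditive_def by blast

lemma plus_neg [simp]: "f \<in> Hom C X Y \<Longrightarrow> f \<ominus> f = zr C X Y"
  using preadd HomD(4,5)[of f X Y] unfolding preadditive_def by blast

lemma comp_plus_left:
  "g \<in> Hom C Y Z \<Longrightarrow> h \<in> Hom C Y Z \<Longrightarrow> f \<in> Hom C X Y \<Longrightarrow> (g \<oplus> h) \<cdot> f = g \<cdot> f \<oplus> h \<cdot> f"
  using preadd unfolding preadditive_def Hom_def by auto

lemma comp_plus_right:
  "h \<in> Hom C Y Z \<Longrightarrow> f \<in> Hom C X Y \<Longrightarrow> g \<in> Hom C X Y \<Longrightarrow> h \<cdot> (f \<oplus> g) = h \<cdot> f \<oplus> h \<cdot> g"
  using preadd unfolding preadditive_def Hom_def by auto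

lemma zero_plus [simp]: "f \<in> Hom C X Y \<Longrightarrow> zr C X Y \<oplus> f = f"
  by (metis HomD(4,5) plus_commute plus_zero zero_Hom)

lemma plus_cancel:
  assumes "f \<in> Hom C X Y" "g \<in> Hom C X Y" "h \<in> Hom C X Y" "f \<oplus> g = f \<oplus> h"
  shows "g = h"
proof -
  have "ng C f \<oplus> f = zr C X Y"
    using assms(1) plus_commute[of "ng C f" X Y f] by auto
  moreover have "ng C f \<oplus> (f \<oplus> g) = ng C f \<oplus> (f \<oplus> h)"
    using assms(4) by simp
  ultimately show ?thesis
    using assms plus_assoc[of "ng C f" X Y f g] plus_assoc[of "ng C f" X Y f h] by simp
qed

lemma minus_eq_zero:
  assumes "f \<in> Hom C X Y" "g \<in> Hom C X Y" "f \<ominus> g = zr C X Y"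
  shows "f = g"
  using plus_cancel[of "ng C g" X Y f g] assms plus_commute[of f X Y "ng C g"]
    plus_commute[of g X Y "ng C g"] by auto

lemma neg_unique: "f \<in> Hom C X Y \<Longrightarrow> g \<in> Hom C X Y \<Longrightarrow> f \<oplus> g = zr C X Y \<Longrightarrow> g = ng C f"
  by (metis plus_cancel plus_neg neg_Hom)

lemma neg_neg [simp]: "f \<in> Hom C X Y \<Longrightarrow> ng C (ng C f) = f"
  by (metis neg_unique plus_neg neg_Hom plus_commute)

lemma comp_zero [simp]:
  assumes "f \<in> Hom C Y Z" "X \<in> obj C"
  shows "f \<cdot> zr C X Y = zr C X Z"
proof -
  note z = zero_Hom[OF assms(2) HomD(4)[OF assms(1)]]
  show ?thesis
    using plus_cancel[of "f \<cdot> zr C X Y" X Z "f \<cdot> zr C X Y" "zr C X Z"]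
      comp_plus_right[OF assms(1) z z] plus_zero[OF z] HomD[OF assms(1)] z assms by auto
qed

lemma zero_comp [simp]:
  assumes "f \<in> Hom C X Y" "Z \<in> obj C"
  shows "zr C Y Z \<cdot> f = zr C X Z"
proof -
  note z = zero_Hom[OF HomD(5)[OF assms(1)] assms(2)]
  show ?thesis
    using plus_cancel[of "zr C Y Z \<cdot> f" X Z "zr C Y Z \<cdot> f" "zr C X Z"]
      comp_plus_left[OF z z assms(1)] plus_zero[OF z] HomD[OF assms(1)] z assms by auto
qed

lemma comp_neg: "g \<in> Hom C Y Z \<Longrightarrow> f \<in> Hom C X Y \<Longrightarrow> g \<cdot> ng C f = ng C (g \<cdot> f)"
  using comp_plus_right[of g Y Z f X "ng C f"] HomD(4,5)[of f X Y]
  by (intro neg_unique[of _ X Z]) (auto simp: neg_Hom)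

lemma neg_comp: "g \<in> Hom C Y Z \<Longrightarrow> f \<in> Hom C X Y \<Longrightarrow> ng C g \<cdot> f = ng C (g \<cdot> f)"
  using comp_plus_left[of g Y Z "ng C g" f X] HomD(4,5)[of g Y Z]
  by (intro neg_unique[of _ X Z]) (auto simp: neg_Hom)

lemma comp_minus_left:
  "g \<in> Hom C Y Z \<Longrightarrow> h \<in> Hom C Y Z \<Longrightarrow> f \<in> Hom C X Y \<Longrightarrow> (g \<ominus> h) \<cdot> f = g \<cdot> f \<ominus> h \<cdot> f"
  by (metis comp_plus_left neg_Hom neg_comp)

lemma comp_minus_right:
  "h \<in> Hom C Y Z \<Longrightarrow> f \<in> Hom C X Y \<Longrightarrow> g \<in> Hom C X Y \<Longrightarrow> h \<cdot> (f \<ominus> g) = h \<cdot> f \<ominus> h \<cdot> g"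
  by (metis comp_plus_right neg_Hom comp_neg)

lemma plus_shuffle:
  assumes "f \<in> Hom C X Y" "g \<in> Hom C X Y" "h \<in> Hom C X Y" "k \<in> Hom C X Y"
  shows "(f \<oplus> g) \<oplus> (h \<oplus> k) = (f \<oplus> h) \<oplus> (g \<oplus> k)"
proof -
  have "g \<oplus> (h \<oplus> k) = h \<oplus> (g \<oplus> k)"
    using plus_assoc[of g X Y h k] plus_assoc[of h X Y g k] plus_commute[of g X Y h] assms by simp
  then show ?thesis
    using assms plus_assoc[of f X Y g "h \<oplus> k"] plus_assoc[of f X Y h "g \<oplus> k"] by auto
qed

lemma neg_plus:
  assumes "f \<in> Hom C X Y" "g \<in> Hom C X Y"
  shows "ng C (f \<oplus> g) = ng C f \<oplus> ng C g"
  using assms plus_shuffle[of f X Y g "ng C f" "ng C g"] HomD(4,5)[OF assms(1)]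
    plus_zero[OF zero_Hom, of X Y] by (intro neg_unique[of _ X Y, symmetric]) simp_all

lemma neg_zero [simp]: "X \<in> obj C \<Longrightarrow> Y \<in> obj C \<Longrightarrow> ng C (zr C X Y) = zr C X Y"
  by (metis neg_unique plus_zero zero_Hom)

lemma minus_zero [simp]: "f \<in> Hom C X Y \<Longrightarrow> f \<ominus> zr C X Y = f"
  using HomD[of f X Y] by simp

lemma minus_plus_cancel:
  assumes "f \<in> Hom C X Y" "g \<in> Hom C X Y"
  shows "f \<ominus> g \<oplus> g = f"
  using assms plus_assoc[of f X Y "ng C g" g] plus_commute[of "ng C g" X Y g] by auto

lemma minus_minus:
  assumes "f \<in> Hom C X Y" "g \<in> Hom C X Y" "h \<in> Hom C X Y"
  shows "f \<ominus> h = (f \<ominus> g) \<oplus> (g \<ominus> h)"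
  using assms plus_assoc[of "f \<ominus> g" X Y g "ng C h"] minus_plus_cancel[of f X Y g] by auto

lemma neg_minus:
  assumes "f \<in> Hom C X Y" "g \<in> Hom C X Y"
  shows "ng C (f \<ominus> g) = g \<ominus> f"
  using assms neg_plus[of f X Y "ng C g"] plus_commute[of "ng C f" X Y g] by auto

end

section \<open>Opposite categories and ideal quotients\<close>

text \<open>In a quotient, \<open>dm\<close> and \<open>cd\<close> of a class go through a chosen
  representative, which makes side conditions like \<open>cd C f = dm C g\<close> awkward. With the
  laws stated on hom-sets, representatives of the right type can be picked at once.\<close>

lemma preadditiveI:
  assumes "\<And>f. f \<in> mor D \<Longrightarrow> dm D f \<in> obj D \<and> cd D f \<in> obj D"
    and "\<And>X. X \<in> obj D \<Longrightarrow> idm D X \<in> Hom D X X"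
    and "\<And>X Y Z f g. f \<in> Hom D X Y \<Longrightarrow> g \<in> Hom D Y Z \<Longrightarrow> cmp D g f \<in> Hom D X Z"
    and "\<And>X Y Z Z' f g h. f \<in> Hom D X Y \<Longrightarrow> g \<in> Hom D Y Z \<Longrightarrow> h \<in> Hom D Z Z' \<Longrightarrow>
           cmp D h (cmp D g f) = cmp D (cmp D h g) f"
    and "\<And>X Y f. f \<in> Hom D X Y \<Longrightarrow> cmp D f (idm D X) = f \<and> cmp D (idm D Y) f = f"
    and "\<And>X Y. X \<in> obj D \<Longrightarrow> Y \<in> obj D \<Longrightarrow> zr D X Y \<in> Hom D X Y"
    and "\<And>X Y f g. f \<in> Hom D X Y \<Longrightarrow> g \<in> Hom D X Y \<Longrightarrow> ad D f g \<in> Hom D X Y"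
    and "\<And>X Y f. f \<in> Hom D X Y \<Longrightarrow> ng D f \<in> Hom D X Y"
    and "\<And>X Y f g h. f \<in> Hom D X Y \<Longrightarrow> g \<in> Hom D X Y \<Longrightarrow> h \<in> Hom D X Y \<Longrightarrow>
           ad D (ad D f g) h = ad D f (ad D g h)"
    and "\<And>X Y f g. f \<in> Hom D X Y \<Longrightarrow> g \<in> Hom D X Y \<Longrightarrow> ad D f g = ad D g f"
    and "\<And>X Y f. f \<in> Hom D X Y \<Longrightarrow> ad D f (zr D X Y) = f \<and> ad D f (ng D f) = zr D X Y"
    and "\<And>X Y Z f g h. f \<in> Hom D X Y \<Longrightarrow> g \<in> Hom D Y Z \<Longrightarrow> h \<in> Hom D Y Z \<Longrightarrow>
           cmp D (ad D g h) f = ad D (cmp D g f) (cmp D h f)"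
    and "\<And>X Y Z f g h. f \<in> Hom D X Y \<Longrightarrow> g \<in> Hom D X Y \<Longrightarrow> h \<in> Hom D Y Z \<Longrightarrow>
           cmp D h (ad D f g) = ad D (cmp D h f) (cmp D h g)"
  shows "preadditive D"
proof -
  have H: "f \<in> Hom D X Y \<longleftrightarrow> f \<in> mor D \<and> dm D f = X \<and> cd D f = Y" for f X Y
    by (simp add: Hom_def)
  have "category D"
    unfolding category_def
    using assms(1-3) assms(4,5)[unfolded H] by (simp add: H)
  then show ?thesis
    unfolding preadditive_def
    using assms(6-11) assms(12,13)[unfolded H] by auto
qed

text \<open>The result is a bare \<open>addcat\<close>: a shift and triangles carried by
  \<open>C\<close> are dropped, so no opposite shift has to be constructed.\<close>

definition op_cat :: "('o,'m,'z) addcat_scheme \<Rightarrow> ('o,'m) addcat" where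
  "op_cat C = \<lparr>obj = obj C, mor = mor C, dm = cd C, cd = dm C, idm = idm C,
     cmp = (\<lambda>g f. cmp C f g), zr = (\<lambda>X Y. zr C Y X), ad = ad C, ng = ng C\<rparr>"

lemma op_cat_simps [simp]:
  "obj (op_cat C) = obj C" "mor (op_cat C) = mor C" "dm (op_cat C) = cd C" "cd (op_cat C) = dm C"
  "idm (op_cat C) = idm C" "cmp (op_cat C) g f = cmp C f g" "zr (op_cat C) X Y = zr C Y X"
  "ad (op_cat C) = ad C" "ng (op_cat C) = ng C"
  by (simp_all add: op_cat_def)

lemma Hom_op_cat [simp]: "Hom (op_cat C) X Y = Hom C Y X"
  by (auto simp: Hom_def)

lemma preadditive_op_cat:
  assumes "preadditive C"
  shows "preadditive (op_cat C)"
proof -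
  interpret preadd_cat C by standard fact
  show ?thesis
    by (rule preadditiveI)
      (auto simp: comp_assoc plus_assoc comp_plus_left comp_plus_right mor_objs intro: plus_commute)
qed

lemma is_biprod_op_cat [simp]: "is_biprod (op_cat C) = is_biprod C"
  unfolding is_biprod_def by (intro ext) (auto; blast)

lemma zero_obj_op_cat [simp]: "zero_obj (op_cat C) = zero_obj C"
  unfolding zero_obj_def by auto

lemma additive_op_cat: "additive C \<Longrightarrow> additive (op_cat C)"
  unfolding additive_def by (simp add: preadditive_op_cat)

lemma is_cokernel_op_cat [simp]: "is_cokernel (op_cat C) f k \<longleftrightarrow> is_kernel C f k"
  unfolding is_cokernel_def is_kernel_def by simp

lemma epi_op_cat [simp]: "epi (op_cat C) f \<longleftrightarrow> mono C f"
  unfolding epi_def mono_def by simp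

text \<open>Reversing arrows turns the square by half a turn: the old bottom arrow becomes the top
  one and the verticals trade places.\<close>

lemma pullback_square_op_cat [simp]:
  "pullback_square (op_cat C) \<delta> \<gamma> \<beta> \<alpha> \<longleftrightarrow> pushout_square C \<alpha> \<beta> \<gamma> \<delta>"
  unfolding pullback_square_def pushout_square_def comm_square_def
  by (simp, safe; (metis | blast))

lemma right_semi_abelian_iff: "right_semi_abelian C \<longleftrightarrow> left_semi_abelian (op_cat C)"
  unfolding right_semi_abelian_def left_semi_abelian_def cokernel_morphism_def kernel_morphism_def
  by (auto; blast)

lemma factors_through_op_cat [simp]: "factors_through (op_cat C) W h \<longleftrightarrow> factors_through C W h"
  unfolding factors_through_def by (auto; blast)

text \<open>An equality of records, not merely an equivalence: a class is a set of morphisms that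
  reversal leaves alone, so \<open>rep\<close> picks the same element on both sides.\<close>

lemma ideal_quotient_op_cat: "ideal_quotient (op_cat C) H W = op_cat (ideal_quotient C H W)"
proof -
  have "cls (op_cat C) W = cls C W"
    unfolding cls_def by auto
  then show ?thesis
    unfolding ideal_quotient_def op_cat_def[of "\<lparr>obj = _, mor = _, dm = _, cd = _, idm = _, cmp = _, zr = _, ad = _, ng = _\<rparr>"]
    by auto
qed

section \<open>Quotients by the ideal of morphisms factoring through W\<close>

locale additive_cat = preadd_cat C for C :: "('o,'m,'z) addcat_scheme" +
  assumes add: "additive C"

lemma additive_catI: "additive C \<Longrightarrow> additive_cat C"
  by unfold_locales (auto simp: additive_def)

locale quotient_cat = additive_cat C for C :: "('o,'m,'z) addcat_scheme" +
  fixes H W :: "'o set"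
  assumes H_obj: "H \<subseteq> obj C" and W_obj: "W \<subseteq> obj C" and W_ne: "W \<noteq> {}"
    and W_biprod: "\<And>X Y B. X \<in> W \<Longrightarrow> Y \<in> W \<Longrightarrow> is_biprod C X Y B \<Longrightarrow> B \<in> W"
begin

abbreviation in_ideal where "in_ideal \<equiv> factors_through C W"
abbreviation Q where "Q \<equiv> ideal_quotient C H W"
abbreviation q where "q \<equiv> cls C W"

lemma in_idealI: "w \<in> W \<Longrightarrow> a \<in> Hom C X w \<Longrightarrow> b \<in> Hom C w Y \<Longrightarrow> in_ideal (b \<cdot> a)"
  unfolding factors_through_def using HomD(2,3)[OF comp_Hom[of b w Y a X]] by auto

lemma in_idealE:
  assumes "in_ideal f" "f \<in> Hom C X Y"
  obtains w a b where "w \<in> W" "a \<in> Hom C X w" "b \<in> Hom C w Y" "f = b \<cdot> a"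
  using assms HomD(2,3)[OF assms(2)] unfolding factors_through_def by blast

lemma in_ideal_zero: "X \<in> obj C \<Longrightarrow> Y \<in> obj C \<Longrightarrow> in_ideal (zr C X Y)"
proof -
  assume X: "X \<in> obj C" and Y: "Y \<in> obj C"
  obtain w where w: "w \<in> W" "w \<in> obj C" using W_ne W_obj by auto
  have "zr C w Y \<cdot> zr C X w = zr C X Y" using X Y w by (simp add: comp_zero[of _ w Y X])
  then show ?thesis using in_idealI[OF w(1) zero_Hom[OF X w(2)] zero_Hom[OF w(2) Y]] by simp
qed

lemma in_ideal_comp_left:
  assumes "in_ideal f" "f \<in> Hom C X Y" "g \<in> Hom C Y Z"
  shows "in_ideal (g \<cdot> f)"
proof -
  obtain w a b where w: "w \<in> W" "a \<in> Hom C X w" "b \<in> Hom C w Y" "f = b \<cdot> a"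
    using in_idealE[OF assms(1,2)] .
  then show ?thesis
    using in_idealI[OF w(1,2), of "g \<cdot> b" Z] comp_assoc[OF assms(3) w(3,2)] assms(3) by auto
qed

lemma in_ideal_comp_right:
  assumes "in_ideal g" "g \<in> Hom C Y Z" "f \<in> Hom C X Y"
  shows "in_ideal (g \<cdot> f)"
proof -
  obtain w a b where w: "w \<in> W" "a \<in> Hom C Y w" "b \<in> Hom C w Z" "g = b \<cdot> a"
    using in_idealE[OF assms(1,2)] .
  then show ?thesis
    using in_idealI[OF w(1), of "a \<cdot> f" X b Z] comp_assoc[OF w(3,2) assms(3)] assms(3) by auto
qed

lemma in_ideal_neg:
  assumes "in_ideal f" "f \<in> Hom C X Y"
  shows "in_ideal (ng C f)"
proof -
  obtain w a b where w: "w \<in> W" "a \<in> Hom C X w" "b \<in> Hom C w Y" "f = b \<cdot> a"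
    using in_idealE[OF assms(1,2)] .
  then show ?thesis
    using in_idealI[OF w(1), of a X "ng C b" Y] neg_comp[OF w(3,2)] by auto
qed

lemma in_ideal_plus:
  assumes "in_ideal f" "f \<in> Hom C X Y" "in_ideal g" "g \<in> Hom C X Y"
  shows "in_ideal (f \<oplus> g)"
proof -
  obtain w a b where w: "w \<in> W" "a \<in> Hom C X w" "b \<in> Hom C w Y" "f = b \<cdot> a"
    using in_idealE[OF assms(1,2)] .
  obtain v c d where v: "v \<in> W" "c \<in> Hom C X v" "d \<in> Hom C v Y" "g = d \<cdot> c"
    using in_idealE[OF assms(3,4)] .
  obtain B where B: "is_biprod C w v B"
    using add w(1) v(1) W_obj unfolding additive_def by blast
  then obtain i j p r where ij: "i \<in> Hom C w B" "j \<in> Hom C v B" "p \<in> Hom C B w" "r \<in> Hom C B v"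
    and e: "p \<cdot> i = idm C w" "r \<cdot> j = idm C v" "r \<cdot> i = zr C w v" "p \<cdot> j = zr C v w"
    unfolding is_biprod_def by blast
  \<comment> \<open>The column (a, c) into the biproduct and the row (b, d) out of it; their
    composite is b a + d c.\<close>
  let ?u = "i \<cdot> a \<oplus> j \<cdot> c" and ?v = "b \<cdot> p \<oplus> d \<cdot> r"
  have u: "?u \<in> Hom C X B" "?v \<in> Hom C B Y" using ij w v by auto
  have pu: "p \<cdot> ?u = a" "r \<cdot> ?u = c"
    using comp_plus_right[of p B w "i \<cdot> a" X "j \<cdot> c"] comp_plus_right[of r B v "i \<cdot> a" X "j \<cdot> c"]
      ij w(2) v(2) HomD(4,5)[OF w(2)] HomD(4,5)[OF v(2)]
      comp_assoc[OF ij(3,1) w(2)] comp_assoc[OF ij(3,2) v(2)]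
      comp_assoc[OF ij(4,1) w(2)] comp_assoc[OF ij(4,2) v(2)]
    by (auto simp: e)
  have "?v \<cdot> ?u = (b \<cdot> p) \<cdot> ?u \<oplus> (d \<cdot> r) \<cdot> ?u"
    using comp_plus_left[of "b \<cdot> p" B Y "d \<cdot> r" ?u X] ij w v u by auto
  also have "\<dots> = f \<oplus> g"
    using comp_assoc[OF w(3) ij(3) u(1)] comp_assoc[OF v(3) ij(4) u(1)] w(4) v(4) pu by simp
  finally show ?thesis
    using in_idealI[OF W_biprod[OF w(1) v(1) B] u] by simp
qed

lemma self_in_cls: "f \<in> Hom C X Y \<Longrightarrow> f \<in> q f"
  using HomD[of f X Y] in_ideal_zero[of X Y] by (simp add: cls_def)

lemma in_cls: "f \<in> Hom C X Y \<Longrightarrow> g \<in> q f \<longleftrightarrow> g \<in> Hom C X Y \<and> in_ideal (g \<ominus> f)"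
  using HomD(2,3)[of f X Y] by (auto simp: cls_def)

lemma cls_eqI:
  assumes "f \<in> Hom C X Y" "g \<in> Hom C X Y" "in_ideal (f \<ominus> g)"
  shows "q f = q g"
proof -
  have *: "h \<in> q g" if "f \<in> Hom C X Y" "g \<in> Hom C X Y" "in_ideal (f \<ominus> g)" "h \<in> q f" for f g h
  proof -
    have h: "h \<in> Hom C X Y" "in_ideal (h \<ominus> f)" using that in_cls by auto
    then have "in_ideal ((h \<ominus> f) \<oplus> (f \<ominus> g))"
      using that by (intro in_ideal_plus[of "h \<ominus> f" X Y "f \<ominus> g"]) simp_all
    then show ?thesis using h that in_cls minus_minus[of h X Y f g] by simp
  qed
  have "in_ideal (g \<ominus> f)"
    using in_ideal_neg[OF assms(3), of X Y] neg_minus[OF assms(1,2)] assms by simp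
  then show ?thesis using *[of f g] *[of g f] assms by auto
qed

lemma cls_eqD: "f \<in> Hom C X Y \<Longrightarrow> g \<in> Hom C X Y \<Longrightarrow> q f = q g \<Longrightarrow> in_ideal (f \<ominus> g)"
  using self_in_cls in_cls by blast

lemma cls_zero_iff: "f \<in> Hom C X Y \<Longrightarrow> q f = q (zr C X Y) \<longleftrightarrow> in_ideal f"
  using cls_eqI[of f X Y "zr C X Y"] cls_eqD[of f X Y "zr C X Y"] HomD(4,5)[of f X Y] by auto

lemma rep_cls:
  assumes "f \<in> Hom C X Y"
  shows "rep (q f) \<in> Hom C X Y" "in_ideal (rep (q f) \<ominus> f)"
proof -
  have "rep (q f) \<in> q f"
    unfolding rep_def using self_in_cls[OF assms] by (rule someI)
  then show "rep (q f) \<in> Hom C X Y" "in_ideal (rep (q f) \<ominus> f)"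
    using in_cls[OF assms] by auto
qed

lemma quot_simps [simp]:
  "obj Q = H" "idm Q X = q (idm C X)" "zr Q X Y = q (zr C X Y)"
  by (simp_all add: ideal_quotient_def)

text \<open>Independence of representatives: g' f' - g f = g' (f' - f) + (g' - g) f, and both
  summands lie in the ideal.\<close>

lemma quot_comp:
  assumes "f \<in> Hom C X Y" "g \<in> Hom C Y Z"
  shows "cmp Q (q g) (q f) = q (g \<cdot> f)"
proof -
  let ?f = "rep (q f)" and ?g = "rep (q g)"
  note f = rep_cls[OF assms(1)] and g = rep_cls[OF assms(2)]
  have "?g \<cdot> ?f \<ominus> g \<cdot> f = (?g \<cdot> ?f \<ominus> ?g \<cdot> f) \<oplus> (?g \<cdot> f \<ominus> g \<cdot> f)"
    using f g assms by (intro minus_minus[of _ X Z]) auto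
  also have "\<dots> = ?g \<cdot> (?f \<ominus> f) \<oplus> (?g \<ominus> g) \<cdot> f"
    using f g assms comp_minus_left[of ?g Y Z g f X] comp_minus_right[of ?g Y Z ?f X f] by simp
  finally have "in_ideal (?g \<cdot> ?f \<ominus> g \<cdot> f)"
    using f g assms in_ideal_comp_left[OF f(2), of X Y ?g Z] in_ideal_comp_right[OF g(2), of Y Z f X]
      in_ideal_plus[of "?g \<cdot> (?f \<ominus> f)" X Z "(?g \<ominus> g) \<cdot> f"]
    by (auto simp: comp_Hom[of _ Y])
  then have "q (?g \<cdot> ?f) = q (g \<cdot> f)"
    using f g assms by (intro cls_eqI[of _ X Z]) auto
  then show ?thesis by (simp add: ideal_quotient_def)
qed

lemma quot_plus:
  assumes "f \<in> Hom C X Y" "g \<in> Hom C X Y"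
  shows "ad Q (q f) (q g) = q (f \<oplus> g)"
proof -
  let ?f = "rep (q f)" and ?g = "rep (q g)"
  note f = rep_cls[OF assms(1)] and g = rep_cls[OF assms(2)]
  have "(?f \<oplus> ?g) \<ominus> (f \<oplus> g) = (?f \<ominus> f) \<oplus> (?g \<ominus> g)"
    using f g assms plus_shuffle[of ?f X Y ?g "ng C f" "ng C g"] neg_plus[of f X Y g] by simp
  then have "q (?f \<oplus> ?g) = q (f \<oplus> g)"
    using f g assms in_ideal_plus[OF f(2) _ g(2), of X Y] by (intro cls_eqI[of _ X Y]) auto
  then show ?thesis by (simp add: ideal_quotient_def)
qed

lemma quot_neg:
  assumes "f \<in> Hom C X Y"
  shows "ng Q (q f) = q (ng C f)"
proof -
  note f = rep_cls[OF assms]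
  have "ng C (rep (q f)) \<ominus> ng C f = ng C (rep (q f) \<ominus> f)"
    using f assms neg_plus[of "rep (q f)" X Y "ng C f"] by simp
  then have "q (ng C (rep (q f))) = q (ng C f)"
    using f assms in_ideal_neg[OF f(2), of X Y] by (intro cls_eqI[of _ X Y]) auto
  then show ?thesis by (simp add: ideal_quotient_def)
qed

lemma quot_dom_cod:
  assumes "f \<in> Hom C X Y"
  shows "dm Q (q f) = X" "cd Q (q f) = Y"
  using HomD(2,3)[OF rep_cls(1)[OF assms]] by (simp_all add: ideal_quotient_def)

lemma quot_HomI [intro, simp]:
  assumes "f \<in> Hom C X Y" "X \<in> H" "Y \<in> H"
  shows "q f \<in> Hom Q X Y"
proof -
  have "q f \<in> mor Q"
    unfolding ideal_quotient_def using HomD[OF assms(1)] assms(2,3) by auto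
  then show ?thesis using quot_dom_cod[OF assms(1)] by (simp add: Hom_def)
qed

lemma quot_HomE:
  assumes "A \<in> Hom Q X Y"
  obtains f where "f \<in> Hom C X Y" "A = q f" "X \<in> H" "Y \<in> H"
proof -
  have "A \<in> mor Q" "dm Q A = X" "cd Q A = Y" using assms by (auto simp: Hom_def)
  then obtain f where f: "f \<in> mor C" "dm C f \<in> H" "cd C f \<in> H" "A = q f"
    by (auto simp: ideal_quotient_def)
  then have "dm C f = X" "cd C f = Y"
    using quot_dom_cod[OF mor_Hom[OF f(1)]] \<open>dm Q A = X\<close> \<open>cd Q A = Y\<close> by auto
  then show ?thesis using that f mor_Hom by auto
qed

lemma quot_morE:
  assumes "A \<in> mor Q"
  obtains f where "f \<in> Hom C (dm Q A) (cd Q A)" "A = q f" "dm Q A \<in> H" "cd Q A \<in> H"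
proof -
  have "A \<in> Hom Q (dm Q A) (cd Q A)" using assms by (simp add: Hom_def)
  then show ?thesis by (rule quot_HomE) (rule that)
qed

lemma preadditive_quot: "preadditive Q"
proof (rule preadditiveI)
  show "dm Q A \<in> obj Q \<and> cd Q A \<in> obj Q" if "A \<in> mor Q" for A
    using that by (elim quot_morE) simp
next
  fix X assume "X \<in> obj Q"
  then show "idm Q X \<in> Hom Q X X" using H_obj by (simp add: subsetD)
next
  fix X Y assume "X \<in> obj Q" "Y \<in> obj Q"
  then show "zr Q X Y \<in> Hom Q X Y" using H_obj by (simp add: subsetD)
next
  fix X Y Z A B assume "A \<in> Hom Q X Y" "B \<in> Hom Q Y Z"
  then show "cmp Q B A \<in> Hom Q X Z"
    by (elim quot_HomE) (simp add: quot_comp[of _ X Y _ Z] comp_Hom[of _ Y Z _ X])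
next
  fix X Y Z Z' A B D assume "A \<in> Hom Q X Y" "B \<in> Hom Q Y Z" "D \<in> Hom Q Z Z'"
  then show "cmp Q D (cmp Q B A) = cmp Q (cmp Q D B) A"
    by (elim quot_HomE)
      (simp add: quot_comp[of _ X Y _ Z] quot_comp[of _ X Z _ Z'] quot_comp[of _ X Y _ Z']
        quot_comp[of _ Y Z _ Z'] comp_Hom[of _ Y Z _ X] comp_Hom[of _ Z Z' _ Y]
        comp_assoc[of _ Z Z' _ Y _ X])
next
  fix X Y A assume "A \<in> Hom Q X Y"
  then obtain f where f: "f \<in> Hom C X Y" "A = q f" by (rule quot_HomE)
  note o = HomD(4,5)[OF f(1)]
  show "cmp Q A (idm Q X) = A \<and> cmp Q (idm Q Y) A = A"
    using quot_comp[OF id_Hom[OF o(1)] f(1)] quot_comp[OF f(1) id_Hom[OF o(2)]] f by simp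
  show "ad Q A (zr Q X Y) = A \<and> ad Q A (ng Q A) = zr Q X Y"
    using quot_plus[OF f(1) zero_Hom[OF o]] quot_plus[OF f(1) neg_Hom[OF f(1)]]
      quot_neg[OF f(1)] f by simp
next
  fix X Y A assume "A \<in> Hom Q X Y"
  then show "ng Q A \<in> Hom Q X Y"
    by (elim quot_HomE) (simp add: quot_neg[of _ X Y])
next
  fix X Y A B assume "A \<in> Hom Q X Y" "B \<in> Hom Q X Y"
  then show "ad Q A B \<in> Hom Q X Y"
    by (elim quot_HomE) (simp add: quot_plus[of _ X Y])
next
  fix X Y A B D assume "A \<in> Hom Q X Y" "B \<in> Hom Q X Y" "D \<in> Hom Q X Y"
  then show "ad Q (ad Q A B) D = ad Q A (ad Q B D)"
    by (elim quot_HomE) (simp add: quot_plus[of _ X Y] plus_assoc[of _ X Y])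
next
  fix X Y A B assume "A \<in> Hom Q X Y" "B \<in> Hom Q X Y"
  then obtain f g where "f \<in> Hom C X Y" "A = q f" "g \<in> Hom C X Y" "B = q g"
    by (elim quot_HomE)
  then show "ad Q A B = ad Q B A"
    by (simp add: quot_plus[of _ X Y] plus_commute[of f X Y])
next
  fix X Y Z A B D assume "A \<in> Hom Q X Y" "B \<in> Hom Q Y Z" "D \<in> Hom Q Y Z"
  then show "cmp Q (ad Q B D) A = ad Q (cmp Q B A) (cmp Q D A)"
    by (elim quot_HomE)
      (simp add: quot_comp[of _ X Y _ Z] quot_plus[of _ X Z] quot_plus[of _ Y Z]
        comp_plus_left[of _ Y Z _ _ X] comp_Hom[of _ Y Z _ X])
next
  fix X Y Z A B D assume "A \<in> Hom Q X Y" "B \<in> Hom Q X Y" "D \<in> Hom Q Y Z"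
  then show "cmp Q D (ad Q A B) = ad Q (cmp Q D A) (cmp Q D B)"
    by (elim quot_HomE)
      (simp add: quot_comp[of _ X Y _ Z] quot_plus[of _ X Z] quot_plus[of _ X Y]
        comp_plus_right[of _ Y Z _ X] comp_Hom[of _ Y Z _ X])
qed

lemma additive_quot:
  assumes "\<exists>Z\<in>H. zero_obj C Z"
    and "\<And>X Y B. X \<in> H \<Longrightarrow> Y \<in> H \<Longrightarrow> is_biprod C X Y B \<Longrightarrow> B \<in> H"
  shows "additive Q"
proof -
  have "\<exists>B. is_biprod Q X Y B" if X: "X \<in> H" and Y: "Y \<in> H" for X Y
  proof -
    obtain B where B: "is_biprod C X Y B"
      using add X Y H_obj unfolding additive_def by blast
    have BH: "B \<in> H" using assms(2)[OF X Y B] .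
    obtain i j p r where ij: "i \<in> Hom C X B" "j \<in> Hom C Y B" "p \<in> Hom C B X" "r \<in> Hom C B Y"
      and e: "p \<cdot> i = idm C X" "r \<cdot> j = idm C Y" "r \<cdot> i = zr C X Y" "p \<cdot> j = zr C Y X"
        "i \<cdot> p \<oplus> j \<cdot> r = idm C B"
      using B unfolding is_biprod_def by blast
    have "is_biprod Q X Y B"
      unfolding is_biprod_def
      using ij X Y BH quot_comp[OF ij(1,3)] quot_comp[OF ij(2,3)] quot_comp[OF ij(1,4)]
        quot_comp[OF ij(2,4)] quot_comp[OF ij(3,1)] quot_comp[OF ij(4,2)]
        quot_plus[of "i \<cdot> p" B B "j \<cdot> r"] e
      by (intro conjI exI[of _ "q i"] exI[of _ "q j"] exI[of _ "q p"] exI[of _ "q r"])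
        (simp_all add: comp_Hom[of _ X B] comp_Hom[of _ Y B])
    then show ?thesis by blast
  qed
  then show ?thesis
    unfolding additive_def using preadditive_quot assms(1) zero_obj_def[of C] zero_obj_def[of Q]
    by (metis quot_simps)
qed

end

section \<open>The heart of a twin pair\<close>

definition ext_star ::
  "('o,'m,'z) addcat_scheme \<Rightarrow> ('o \<Rightarrow> 'm \<Rightarrow> 'o \<Rightarrow> 'm \<Rightarrow> 'o \<Rightarrow> bool) \<Rightarrow> 'o set \<Rightarrow> 'o set \<Rightarrow> 'o set"
  where "ext_star C E M N = {X \<in> obj C. \<exists>A f g B. A \<in> M \<and> B \<in> N \<and> E A f X g B}"

text \<open>\<open>S'\<close> and \<open>V'\<close> stand for \<open>S[-1]\<close> and \<open>V[1]\<close>; \<open>E X f Y g Z\<close> says that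
  \<open>X \<rightarrow> Y \<rightarrow> Z\<close> extends to a distinguished triangle. Passing to the opposite category
  exchanges \<open>S', S, T\<close> with \<open>V', V, U\<close>.\<close>

locale twin_pair = additive_cat C for C :: "('o,'m,'z) addcat_scheme" +
  fixes E :: "'o \<Rightarrow> 'm \<Rightarrow> 'o \<Rightarrow> 'm \<Rightarrow> 'o \<Rightarrow> bool"
    and S' S T U V V' W :: "'o set"
  assumes E_Hom: "E X f Y g Z \<Longrightarrow> f \<in> Hom C X Y \<and> g \<in> Hom C Y Z"
    and E_zero: "E X f Y g Z \<Longrightarrow> g \<cdot> f = zr C X Z"
    and E_wcoker: "E X f Y g Z \<Longrightarrow> u \<in> Hom C Y A \<Longrightarrow> u \<cdot> f = zr C X A \<Longrightarrow> \<exists>v\<in>Hom C Z A. u = v \<cdot> g"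
    and E_wker: "E X f Y g Z \<Longrightarrow> u \<in> Hom C A Y \<Longrightarrow> g \<cdot> u = zr C A Z \<Longrightarrow> \<exists>v\<in>Hom C A X. u = f \<cdot> v"
    and E_cone: "f \<in> Hom C X Y \<Longrightarrow> \<exists>g Z. E X f Y g Z"
    and E_cocone: "g \<in> Hom C Y Z \<Longrightarrow> \<exists>f X. E X f Y g Z"
    and E_octahedron: "E A a X b B \<Longrightarrow> E X x Y y Z \<Longrightarrow> E A (x \<cdot> a) Y c D \<Longrightarrow> \<exists>u v. E B u D v Z"
    and E_octahedron': "E X x Y y Z \<Longrightarrow> E B b Z c D \<Longrightarrow> E A d Y (c \<cdot> y) D \<Longrightarrow> \<exists>u v. E X u A v B"
    and rotate_S: "E P j X m Y \<Longrightarrow> P \<in> S' \<Longrightarrow> \<exists>n s. s \<in> S \<and> E X m Y n s"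
    and rotate_S': "E X m Y n s \<Longrightarrow> s \<in> S \<Longrightarrow> \<exists>P j. P \<in> S' \<and> E P j X m Y"
    and rotate_V: "E Y m X j P \<Longrightarrow> P \<in> V' \<Longrightarrow> \<exists>n v. v \<in> V \<and> E v n Y m X"
    and rotate_V': "E v n Y m X \<Longrightarrow> v \<in> V \<Longrightarrow> \<exists>P j. P \<in> V' \<and> E Y m X j P"
    and decompose_ST: "X \<in> obj C \<Longrightarrow> \<exists>P f g t. P \<in> S' \<and> t \<in> T \<and> E P f X g t"
    and decompose_UV: "X \<in> obj C \<Longrightarrow> \<exists>u f g P. u \<in> U \<and> P \<in> V' \<and> E u f X g P"
    and S'_obj: "S' \<subseteq> obj C" and V'_obj: "V' \<subseteq> obj C"
    and T_eq: "T = {X \<in> obj C. \<forall>P\<in>S'. \<forall>f\<in>Hom C P X. f = zr C P X}"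
    and U_eq: "U = {X \<in> obj C. \<forall>P\<in>V'. \<forall>f\<in>Hom C X P. f = zr C X P}"
    and S_U: "S \<subseteq> U" and V_T: "V \<subseteq> T"
    and W_eq: "W = T \<inter> U"
    and W_zero: "\<exists>Z\<in>W. zero_obj C Z"
    and W_sum: "\<And>X Y B. X \<in> W \<Longrightarrow> Y \<in> W \<Longrightarrow> is_biprod C X Y B \<Longrightarrow> B \<in> W"
begin

abbreviation Cm where "Cm \<equiv> ext_star C E S' W"
abbreviation Cp where "Cp \<equiv> ext_star C E W V'"
abbreviation heart where "heart \<equiv> Cp \<inter> Cm"

sublocale quotient_cat C heart W
proof
  show "heart \<subseteq> obj C" by (auto simp: ext_star_def)
  show "W \<subseteq> obj C" unfolding W_eq by (subst T_eq) blast
  show "W \<noteq> {}" using W_zero by blast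
qed (rule W_sum)

text \<open>The assumptions come in mirror pairs (weak kernel and cokernel, cone and cocone, the two
  octahedra, the rotations for S and V, the two decompositions, \<open>T_eq\<close> and
  \<open>U_eq\<close>), so every goal is the partner of an assumption or is self-dual.\<close>

lemma opposite:
  "twin_pair (op_cat C) (\<lambda>X f Y g Z. E Z g Y f X) V' V U T S S' W"
proof -
  interpret op: additive_cat "op_cat C"
    by (rule additive_catI) (rule additive_op_cat[OF add])
  show ?thesis
  proof (unfold_locales, unfold op_cat_simps Hom_op_cat is_biprod_op_cat zero_obj_op_cat, goal_cases)
    case 1 then show ?case using E_Hom by blast
  next case 2 then show ?case by (rule E_zero)
  next case 3 then show ?case by (rule E_wker)
  next case 4 then show ?case by (rule E_wcoker)
  next case 5 then show ?case by (rule E_cocone)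
  next case 6 then show ?case by (rule E_cone)
  next case 7 then show ?case using E_octahedron' by blast
  next case 8 then show ?case using E_octahedron by blast
  next case 9 then show ?case using rotate_V by blast
  next case 10 then show ?case using rotate_V' by blast
  next case 11 then show ?case using rotate_S by blast
  next case 12 then show ?case using rotate_S' by blast
  next case 13 then show ?case using decompose_UV by blast
  next case 14 then show ?case using decompose_ST by blast
  next case 15 show ?case by (rule V'_obj)
  next case 16 show ?case by (rule S'_obj)
  next case 17 show ?case by (rule U_eq)
  next case 18 show ?case by (rule T_eq)
  next case 19 show ?case by (rule V_T)
  next case 20 show ?case by (rule S_U)
  next case 21 show ?case using W_eq by blast
  next case 22 show ?case by (rule W_zero)
  next case 23 then show ?case by (rule W_sum)
  qed
qed

text \<open>Sub and quotient of a triangle trade places, so \<open>Cm\<close> formed in the opposite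
  is literally \<open>Cp\<close>.\<close>

lemma ext_star_op: "ext_star (op_cat C) (\<lambda>X f Y g Z. E Z g Y f X) N M = ext_star C E M N"
  by (auto simp: ext_star_def)

section \<open>Vanishing modulo W, deflations and closure of \<open>Cm\<close>\<close>

lemma Hom_S'_T: "P \<in> S' \<Longrightarrow> t \<in> T \<Longrightarrow> f \<in> Hom C P t \<Longrightarrow> f = zr C P t"
  using T_eq by auto

lemma Hom_U_V': "P \<in> V' \<Longrightarrow> u \<in> U \<Longrightarrow> f \<in> Hom C u P \<Longrightarrow> f = zr C u P"
  using U_eq by auto

lemma W_T: "w \<in> W \<Longrightarrow> w \<in> T" and W_U: "w \<in> W \<Longrightarrow> w \<in> U"
  using W_eq by auto

text \<open>In w -> Y -> P with P in \<open>V'\<close>, the composite x -> Y -> P is zero by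
  orthogonality, so f lifts to w.\<close>

lemma U_to_Cp:
  assumes "x \<in> U" "Y \<in> Cp" "f \<in> Hom C x Y"
  shows "in_ideal f"
proof -
  obtain w a b P where w: "w \<in> W" "P \<in> V'" "E w a Y b P"
    using assms(2) by (auto simp: ext_star_def)
  note ab = E_Hom[OF w(3)]
  have "b \<cdot> f = zr C x P" using Hom_U_V'[OF w(2) assms(1)] ab assms(3) by blast
  then obtain v where "v \<in> Hom C x w" "f = a \<cdot> v" using E_wker[OF w(3) assms(3)] by blast
  then show ?thesis using in_idealI[OF w(1)] ab by blast
qed

lemma in_ideal_S':
  assumes "in_ideal f" "f \<in> Hom C X Y" "P \<in> S'" "a \<in> Hom C P X"
  shows "f \<cdot> a = zr C P Y"
proof -
  obtain w c d where w: "w \<in> W" "c \<in> Hom C X w" "d \<in> Hom C w Y" "f = d \<cdot> c"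
    using in_idealE[OF assms(1,2)] .
  have "c \<cdot> a = zr C P w" using Hom_S'_T[OF assms(3) W_T[OF w(1)]] w(2) assms(4) by blast
  then show ?thesis
    using comp_assoc[OF w(3,2) assms(4)] w(3,4) HomD(4)[OF assms(4)] by simp
qed

text \<open>Converse to \<open>in_ideal_S'\<close>: once f kills the \<open>S'\<close>-part of X, it
  extends along \<open>a\<close> and so factors through w.\<close>

lemma in_ideal_if_zero_on_S':
  assumes "E P s X a w" "w \<in> W" "f \<in> Hom C X Y" "f \<cdot> s = zr C P Y"
  shows "in_ideal f"
  using E_wcoker[OF assms(1,3,4)] E_Hom[OF assms(1)] in_idealI[OF assms(2)] by blast

text \<open>Both rotations are kept for the same m: the \<open>S'\<close> side extends maps into T
  along m, the S side factors maps that vanish on m. By \<open>deflationI\<close> and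
  \<open>deflationI'\<close> either side supplies the other.\<close>

definition deflation where
  "deflation X m Y \<longleftrightarrow> (\<exists>P j s n. P \<in> S' \<and> s \<in> S \<and> E P j X m Y \<and> E X m Y n s)"

lemma deflationI: "E P j X m Y \<Longrightarrow> P \<in> S' \<Longrightarrow> deflation X m Y"
  unfolding deflation_def using rotate_S by blast

lemma deflationI': "E X m Y n s \<Longrightarrow> s \<in> S \<Longrightarrow> deflation X m Y"
  unfolding deflation_def using rotate_S' by blast

lemma deflationE:
  assumes "deflation X m Y"
  obtains P j s n where "P \<in> S'" "s \<in> S" "E P j X m Y" "E X m Y n s"
    "j \<in> Hom C P X" "m \<in> Hom C X Y" "n \<in> Hom C Y s"
  using assms E_Hom unfolding deflation_def by metis

text \<open>Write h m = b a through w in W. Since W lies in T, \<open>a\<close> kills the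
  \<open>S'\<close>-part and extends to a' with a = a' m. Then h - b a' kills m, so it factors
  through s in S. As S lies in U, \<open>U_to_Cp\<close> puts it in the ideal, and b a' is there
  already.\<close>

lemma deflation_epi:
  assumes "deflation X m X'" "Y \<in> Cp" "h \<in> Hom C X' Y" "in_ideal (h \<cdot> m)"
  shows "in_ideal h"
proof -
  obtain P j s n where d: "P \<in> S'" "s \<in> S" "E P j X m X'" "E X m X' n s"
    "j \<in> Hom C P X" "m \<in> Hom C X X'" "n \<in> Hom C X' s"
    using deflationE[OF assms(1)] .
  obtain w a b where w: "w \<in> W" "a \<in> Hom C X w" "b \<in> Hom C w Y" "h \<cdot> m = b \<cdot> a"
    using in_idealE[OF assms(4)] assms(3) d(6) by blast
  have "a \<cdot> j = zr C P w" using Hom_S'_T[OF d(1) W_T[OF w(1)]] w(2) d(5) by blast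
  then obtain a' where a': "a' \<in> Hom C X' w" "a = a' \<cdot> m" using E_wcoker[OF d(3) w(2)] by blast
  have ba: "b \<cdot> a' \<in> Hom C X' Y" "in_ideal (b \<cdot> a')" using a' w in_idealI[OF w(1)] by auto
  have "(h \<ominus> b \<cdot> a') \<cdot> m = h \<cdot> m \<ominus> (b \<cdot> a') \<cdot> m"
    by (rule comp_minus_left[OF assms(3) ba(1) d(6)])
  also have "\<dots> = zr C X Y"
    using w(4) a'(2) comp_assoc[OF w(3) a'(1) d(6)] plus_neg[OF comp_Hom[OF assms(3) d(6)]] by simp
  finally obtain k where k: "k \<in> Hom C s Y" "h \<ominus> b \<cdot> a' = k \<cdot> n"
    using E_wcoker[OF d(4), of "h \<ominus> b \<cdot> a'" Y] assms(3) ba(1) by auto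
  have "in_ideal (h \<ominus> b \<cdot> a')"
    unfolding k(2) using U_to_Cp[of s Y k] k(1) d(2,7) S_U assms(2) in_ideal_comp_right[of k s Y n X'] by auto
  then have "in_ideal (h \<ominus> b \<cdot> a' \<oplus> b \<cdot> a')"
    using ba assms(3) in_ideal_plus[of "h \<ominus> b \<cdot> a'" X' Y "b \<cdot> a'"] by simp
  then show ?thesis using minus_plus_cancel[OF assms(3) ba(1)] by simp
qed

text \<open>A map from Y to \<open>V'\<close> that vanishes on X factors through s, and s lies in U,
  so the map is zero; by \<open>U_eq\<close> this means Y is in U. It serves to show that the T-part
  of a decomposition lies in W.\<close>

lemma target_in_U:
  assumes "E X t Y n s" "s \<in> S" "\<And>P \<phi>. P \<in> V' \<Longrightarrow> \<phi> \<in> Hom C Y P \<Longrightarrow> \<phi> \<cdot> t = zr C X P"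
  shows "Y \<in> U"
proof -
  note tn = E_Hom[OF assms(1)]
  have "\<phi> = zr C Y P" if P: "P \<in> V'" "\<phi> \<in> Hom C Y P" for P \<phi>
  proof -
    obtain k where k: "k \<in> Hom C s P" "\<phi> = k \<cdot> n"
      using E_wcoker[OF assms(1) P(2) assms(3)[OF P]] by blast
    then have "k = zr C s P" using Hom_U_V'[OF P(1)] S_U assms(2) by blast
    then show ?thesis using k tn HomD(5)[OF P(2)] by simp
  qed
  then show ?thesis using U_eq HomD(5) tn by blast
qed

text \<open>Unlike the definition of \<open>Cm\<close>, this criterion makes closure under biproducts evident.\<close>

lemma Cm_iff:
  "X \<in> Cm \<longleftrightarrow> X \<in> obj C \<and> (\<forall>Y\<in>V'. \<forall>\<phi>\<in>Hom C X Y.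
     (\<forall>P\<in>S'. \<forall>a\<in>Hom C P X. \<phi> \<cdot> a = zr C P Y) \<longrightarrow> \<phi> = zr C X Y)" (is "_ \<longleftrightarrow> _ \<and> ?R")
proof (intro iffI conjI)
  assume X: "X \<in> Cm"
  then show "X \<in> obj C" by (simp add: ext_star_def)
  obtain P s a w where w: "P \<in> S'" "w \<in> W" "E P s X a w"
    using X by (auto simp: ext_star_def)
  show ?R
  proof (intro ballI impI)
    fix Y \<phi> assume Y: "Y \<in> V'" "\<phi> \<in> Hom C X Y" "\<forall>P\<in>S'. \<forall>a\<in>Hom C P X. \<phi> \<cdot> a = zr C P Y"
    obtain k where k: "k \<in> Hom C w Y" "\<phi> = k \<cdot> a"
      using E_wcoker[OF w(3) Y(2)] E_Hom[OF w(3)] Y(3) w(1) by blast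
    have "k = zr C w Y" using Hom_U_V'[OF Y(1) W_U[OF w(2)] k(1)] .
    then show "\<phi> = zr C X Y" using k E_Hom[OF w(3)] HomD(5)[OF Y(2)] by simp
  qed
next
  assume "X \<in> obj C \<and> ?R"
  then have X: "X \<in> obj C" and R: ?R by auto
  obtain P s a t where t: "P \<in> S'" "t \<in> T" "E P s X a t" using decompose_ST[OF X] by blast
  note sa = E_Hom[OF t(3)]
  obtain n s' where n: "s' \<in> S" "E X a t n s'" using rotate_S[OF t(3,1)] by blast
  \<comment> \<open>Maps from \<open>S'\<close> into X die in t because t is in T. So the composite
    of any map t -> \<open>V'\<close> with \<open>a\<close> satisfies the hypothesis of the
    criterion and vanishes.\<close>
  have "t \<in> U"
  proof (rule target_in_U[OF n(2,1)])
    fix Y \<phi> assume Y: "Y \<in> V'" "\<phi> \<in> Hom C t Y"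
    have "(\<phi> \<cdot> a) \<cdot> b = zr C Q Y" if b: "Q \<in> S'" "b \<in> Hom C Q X" for Q b
    proof -
      have "a \<cdot> b = zr C Q t" using Hom_S'_T[OF b(1) t(2)] sa b by blast
      then show ?thesis using comp_assoc[of \<phi> t Y a X b Q] sa b Y HomD(4)[OF b(2)] by simp
    qed
    then show "\<phi> \<cdot> a = zr C X Y" using R Y sa by blast
  qed
  then have "t \<in> W" using t(2) W_eq by simp
  then show "X \<in> Cm" unfolding ext_star_def using X t(1,3) by blast
qed

lemma Cm_obj: "X \<in> Cm \<Longrightarrow> X \<in> obj C"
  by (simp add: ext_star_def)

text \<open>By the vanishing criterion: a test map on Y becomes zero after m, since X passes the
  test, and so factors through s in S, which has no nonzero map to \<open>V'\<close>.\<close>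

lemma deflation_Cm:
  assumes "deflation X m Y" "X \<in> Cm"
  shows "Y \<in> Cm"
  unfolding Cm_iff
proof (intro conjI ballI impI)
  obtain P j s n where d: "P \<in> S'" "s \<in> S" "E P j X m Y" "E X m Y n s"
    "j \<in> Hom C P X" "m \<in> Hom C X Y" "n \<in> Hom C Y s"
    using deflationE[OF assms(1)] .
  show "Y \<in> obj C" by (rule HomD(5)[OF d(6)])
  fix Z \<phi> assume Z: "Z \<in> V'" "\<phi> \<in> Hom C Y Z" "\<forall>P\<in>S'. \<forall>a\<in>Hom C P Y. \<phi> \<cdot> a = zr C P Z"
  have "(\<phi> \<cdot> m) \<cdot> a = zr C A Z" if "A \<in> S'" "a \<in> Hom C A X" for A a
    using Z(3) that d(6) comp_assoc[OF Z(2) d(6) that(2)] by auto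
  then have "\<phi> \<cdot> m = zr C X Z" using assms(2) Z d(6) unfolding Cm_iff by blast
  then obtain k where k: "k \<in> Hom C s Z" "\<phi> = k \<cdot> n" using E_wcoker[OF d(4) Z(2)] by blast
  then have "k = zr C s Z" using Hom_U_V'[OF Z(1)] S_U d(2) by blast
  then show "\<phi> = zr C Y Z" using k d(7) HomD(5)[OF Z(2)] by simp
qed

text \<open>Take the cocone K of X -> Y -> w. The octahedron exhibits K as an extension of P' by P,
  both in \<open>S'\<close>. A test map that vanishes on \<open>S'\<close> then vanishes on K,
  factors through w, and is zero because W lies in U.\<close>

lemma Cm_deflation:
  assumes "deflation X m Y" "Y \<in> Cm"
  shows "X \<in> Cm"
  unfolding Cm_iff
proof (intro conjI ballI impI)
  obtain P j s n where d: "P \<in> S'" "s \<in> S" "E P j X m Y" "E X m Y n s"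
    "j \<in> Hom C P X" "m \<in> Hom C X Y" "n \<in> Hom C Y s"
    using deflationE[OF assms(1)] .
  show X: "X \<in> obj C" by (rule HomD(4)[OF d(6)])
  obtain P' s' a w where w: "P' \<in> S'" "w \<in> W" "E P' s' Y a w"
    using assms(2) by (auto simp: ext_star_def)
  note sa = E_Hom[OF w(3)]
  then have am: "a \<cdot> m \<in> Hom C X w" using d(6) by blast
  obtain k K where k: "E K k X (a \<cdot> m) w" using E_cocone[OF am] by blast
  note kH = conjunct1[OF E_Hom[OF k]]
  obtain u v where uv: "E P u K v P'" using E_octahedron'[OF d(3) w(3) k] by blast
  note uvH = E_Hom[OF uv]
  fix Z \<phi> assume Z: "Z \<in> V'" "\<phi> \<in> Hom C X Z" "\<forall>P\<in>S'. \<forall>a\<in>Hom C P X. \<phi> \<cdot> a = zr C P Z"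
  have "\<phi> \<cdot> k = zr C K Z"
  proof -
    \<comment> \<open>Instead of showing K in \<open>S'\<close>, it suffices that K is a retract of
      some L in \<open>S'\<close>. The T-part r of K vanishes on P, hence factors through P', hence
      is zero; so the identity of K lifts along l.\<close>
    obtain L l r t where t: "L \<in> S'" "t \<in> T" "E L l K r t"
      using decompose_ST[OF HomD(4)[OF kH]] by blast
    note lr = E_Hom[OF t(3)]
    have "r \<cdot> u = zr C P t" using Hom_S'_T[OF d(1) t(2)] lr uvH by blast
    then obtain r' where r': "r' \<in> Hom C P' t" "r = r' \<cdot> v" using E_wcoker[OF uv] lr by blast
    then have "r = zr C K t"
      using Hom_S'_T[OF w(1) t(2) r'(1)] uvH HomD(5)[OF r'(1)] by simp
    then obtain c where c: "c \<in> Hom C K L" "idm C K = l \<cdot> c"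
      using E_wker[OF t(3) id_Hom[OF HomD(4)[OF kH]]] lr by auto
    have "\<phi> \<cdot> k = (\<phi> \<cdot> k) \<cdot> (l \<cdot> c)" using c(2) id_right[OF comp_Hom[OF Z(2) kH]] by simp
    also have "\<dots> = (\<phi> \<cdot> (k \<cdot> l)) \<cdot> c"
      using comp_assoc[OF comp_Hom[OF Z(2) kH] conjunct1[OF lr] c(1)]
        comp_assoc[OF Z(2) kH conjunct1[OF lr]] by simp
    also have "\<dots> = zr C K Z"
    proof -
      have "\<phi> \<cdot> (k \<cdot> l) = zr C L Z" using Z(3) t(1) kH lr by blast
      then show ?thesis using c(1) HomD(5)[OF Z(2)] by simp
    qed
    finally show ?thesis .
  qed
  then obtain b where b: "b \<in> Hom C w Z" "\<phi> = b \<cdot> (a \<cdot> m)" using E_wcoker[OF k Z(2)] by blast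
  then have "b = zr C w Z" using Hom_U_V'[OF Z(1) W_U[OF w(2)]] by blast
  then show "\<phi> = zr C X Z" using b am HomD(5)[OF Z(2)] by simp
qed

lemma Cm_zero:
  assumes "zero_obj C Z"
  shows "Z \<in> Cm"
proof -
  have Z: "Z \<in> obj C" "idm C Z = zr C Z Z" using assms by (auto simp: zero_obj_def)
  have "\<phi> = zr C Z Y" if "\<phi> \<in> Hom C Z Y" for Y \<phi>
    using id_right[OF that] comp_zero[OF that Z(1)] Z(2) by simp
  then show ?thesis unfolding Cm_iff using Z(1) by blast
qed

lemma Cm_biprod:
  assumes "is_biprod C X Y B" "X \<in> Cm" "Y \<in> Cm"
  shows "B \<in> Cm"
  unfolding Cm_iff
proof (intro conjI ballI impI)
  obtain i j p r where ij: "i \<in> Hom C X B" "j \<in> Hom C Y B" "p \<in> Hom C B X" "r \<in> Hom C B Y"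
    and e: "i \<cdot> p \<oplus> j \<cdot> r = idm C B"
    using assms(1) unfolding is_biprod_def by blast
  show B: "B \<in> obj C" by (rule HomD(5)[OF ij(1)])
  fix Z \<phi> assume Z: "Z \<in> V'" "\<phi> \<in> Hom C B Z" "\<forall>P\<in>S'. \<forall>a\<in>Hom C P B. \<phi> \<cdot> a = zr C P Z"
  have *: "\<phi> \<cdot> k = zr C A Z" if k: "k \<in> Hom C A B" "A \<in> Cm" for k A
  proof -
    have "(\<phi> \<cdot> k) \<cdot> a = zr C P Z" if "P \<in> S'" "a \<in> Hom C P A" for P a
      using Z(3) that k(1) comp_assoc[OF Z(2) k(1) that(2)] by auto
    then show ?thesis using k Z unfolding Cm_iff by blast
  qed
  have "\<phi> = \<phi> \<cdot> (i \<cdot> p) \<oplus> \<phi> \<cdot> (j \<cdot> r)"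
    using comp_plus_right[OF Z(2) comp_Hom[OF ij(1,3)] comp_Hom[OF ij(2,4)]] e id_right[OF Z(2)] by simp
  also have "\<dots> = (\<phi> \<cdot> i) \<cdot> p \<oplus> (\<phi> \<cdot> j) \<cdot> r"
    using comp_assoc[OF Z(2) ij(1,3)] comp_assoc[OF Z(2) ij(2,4)] by simp
  also have "\<dots> = zr C B Z"
    using *[OF ij(1) assms(2)] *[OF ij(2) assms(3)] ij(3,4) HomD(5)[OF Z(2)] B
      plus_zero[OF zero_Hom, of B Z] by simp
  finally show "\<phi> = zr C B Z" .
qed

section \<open>Weak pullbacks, reflections and weak cokernels\<close>

lemma deflation_pullback:
  assumes "deflation X m Y" "\<beta> \<in> Hom C B Y"
  obtains A x y where "deflation A x B" "x \<in> Hom C A B" "y \<in> Hom C A X" "m \<cdot> y = \<beta> \<cdot> x"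
proof -
  obtain P j s n where d: "P \<in> S'" "s \<in> S" "E P j X m Y" "E X m Y n s"
    "j \<in> Hom C P X" "m \<in> Hom C X Y" "n \<in> Hom C Y s"
    using deflationE[OF assms(1)] .
  \<comment> \<open>A is the cocone of B -> Y -> s, which makes x a deflation with the same s;
    \<open>\<beta> x\<close> is killed by n and therefore lifts along m. The lift is not unique, so
    this is a weak pullback.\<close>
  obtain x A where x: "E A x B (n \<cdot> \<beta>) s" using E_cocone[of "n \<cdot> \<beta>" B s] d(7) assms(2) by blast
  note xH = conjunct1[OF E_Hom[OF x]]
  have "n \<cdot> (\<beta> \<cdot> x) = zr C A s" using E_zero[OF x] comp_assoc[OF d(7) assms(2) xH] by simp
  then obtain y where "y \<in> Hom C A X" "\<beta> \<cdot> x = m \<cdot> y"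
    using E_wker[OF d(4)] assms(2) xH by blast
  then show ?thesis using that deflationI'[OF x d(2)] xH by simp
qed

text \<open>The reflection of an object of \<open>Cm\<close> into the heart: the cone of
  \<open>P \<rightarrow> u \<rightarrow> X\<close>, where \<open>u \<rightarrow> X\<close> is the right \<open>U\<close>-approximation and \<open>P \<rightarrow> u\<close>
  the \<open>S[-1]\<close>-part of \<open>u\<close>.\<close>

lemma heart_reflection:
  assumes "X \<in> Cm"
  obtains Z z where "Z \<in> heart" "deflation X z Z" "z \<in> Hom C X Z"
    "\<And>Y g. Y \<in> Cp \<Longrightarrow> g \<in> Hom C X Y \<Longrightarrow> \<exists>h\<in>Hom C Z Y. g = h \<cdot> z"
proof -
  obtain u f g R where u: "u \<in> U" "R \<in> V'" "E u f X g R" using decompose_UV[OF Cm_obj[OF assms]] by blast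
  note fg = E_Hom[OF u(3)]
  obtain P i a t where t: "P \<in> S'" "t \<in> T" "E P i u a t"
    using decompose_ST[OF HomD(4)[OF conjunct1[OF fg]]] by blast
  note ia = E_Hom[OF t(3)]
  obtain n s where n: "s \<in> S" "E u a t n s" using rotate_S[OF t(3,1)] by blast
  \<comment> \<open>A map from t to \<open>V'\<close> vanishes after \<open>a\<close>, because u is
    in U.\<close>
  have "t \<in> U"
    using target_in_U[OF n(2,1)] Hom_U_V'[OF _ u(1)] ia by blast
  then have w: "t \<in> W" using t(2) W_eq by simp
  obtain z Z where z: "E P (f \<cdot> i) X z Z" using E_cone[of "f \<cdot> i" P X] fg ia by blast
  note zH = conjunct2[OF E_Hom[OF z]]
  have d: "deflation X z Z" using deflationI[OF z t(1)] .
  \<comment> \<open>Octahedron on P -> u -> X: the cones t, R and Z of \<open>i\<close>,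
    \<open>f\<close> and \<open>f i\<close> form a triangle t -> Z -> R with t in W and R in
    \<open>V'\<close>.\<close>
  obtain p r where "E t p Z r R" using E_octahedron[OF t(3) u(3) z] by blast
  then have "Z \<in> Cp" using w u(2) HomD(5)[OF zH] by (auto simp: ext_star_def)
  then have Z: "Z \<in> heart" using deflation_Cm[OF d assms] by simp
  \<comment> \<open>The restriction of k to u factors through W by \<open>U_to_Cp\<close>, so it
    kills P. Hence k extends over Z strictly, not just modulo W.\<close>
  have "\<exists>h\<in>Hom C Z Y. k = h \<cdot> z" if k: "Y \<in> Cp" "k \<in> Hom C X Y" for Y k
  proof -
    have kf: "k \<cdot> f \<in> Hom C u Y" using k fg by blast
    then have "in_ideal (k \<cdot> f)" using U_to_Cp u(1) k by blast
    then have "(k \<cdot> f) \<cdot> i = zr C P Y" using in_ideal_S'[OF _ kf t(1)] ia by blast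
    then have "k \<cdot> (f \<cdot> i) = zr C P Y"
      using comp_assoc[OF k(2) conjunct1[OF fg] conjunct1[OF ia]] by simp
    then show ?thesis using E_wcoker[OF z k(2)] by blast
  qed
  then show ?thesis using that Z d zH by blast
qed

text \<open>A weak cokernel of f modulo W. Both claims about f reduce to the \<open>S'\<close>-part
  s of A: m f kills s by construction, and g f in the ideal forces g f s = 0, so g extends over the
  cone of f s. Nothing places M in \<open>Cp\<close>, hence the later reflection.\<close>

lemma Cm_cone:
  assumes "f \<in> Hom C A B" "A \<in> Cm" "B \<in> Cm"
  obtains M m where "M \<in> Cm" "deflation B m M" "m \<in> Hom C B M" "in_ideal (m \<cdot> f)"
    "\<And>Y g. g \<in> Hom C B Y \<Longrightarrow> in_ideal (g \<cdot> f) \<Longrightarrow> \<exists>h\<in>Hom C M Y. g = h \<cdot> m"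
proof -
  obtain P s a w where w: "P \<in> S'" "w \<in> W" "E P s A a w"
    using assms(2) by (auto simp: ext_star_def)
  note s = conjunct1[OF E_Hom[OF w(3)]]
  obtain m M where m: "E P (f \<cdot> s) B m M" using E_cone[OF comp_Hom[OF assms(1) s]] by blast
  note mH = conjunct2[OF E_Hom[OF m]]
  have d: "deflation B m M" using deflationI[OF m w(1)] .
  have mf: "in_ideal (m \<cdot> f)"
    using in_ideal_if_zero_on_S'[OF w(3,2) comp_Hom[OF mH assms(1)]]
      E_zero[OF m] comp_assoc[OF mH assms(1) s] by simp
  have "\<exists>h\<in>Hom C M Y. g = h \<cdot> m" if g: "g \<in> Hom C B Y" "in_ideal (g \<cdot> f)" for Y g
    using E_wcoker[OF m g(1)] in_ideal_S'[OF g(2) comp_Hom[OF g(1) assms(1)] w(1) s]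
      comp_assoc[OF g(1) assms(1) s] by simp
  then show ?thesis using that deflation_Cm[OF d assms(3)] d mH mf by blast
qed

lemma deflation2_epi:
  assumes "deflation B m M" "deflation M z Z" "m \<in> Hom C B M" "z \<in> Hom C M Z"
    "Y \<in> Cp" "h \<in> Hom C Z Y" "in_ideal (h \<cdot> (z \<cdot> m))"
  shows "in_ideal h"
proof -
  have "in_ideal ((h \<cdot> z) \<cdot> m)" using assms(7) comp_assoc[OF assms(6,4,3)] by simp
  then have "in_ideal (h \<cdot> z)"
    using deflation_epi[OF assms(1,5) comp_Hom[OF assms(6,4)]] by simp
  then show ?thesis using deflation_epi[OF assms(2,5,6)] by simp
qed

section \<open>Cokernels and pullbacks in the quotient\<close>

lemma quot_cancel:
  assumes "c \<in> Hom C B Z" "Y \<in> heart" "\<And>h. h \<in> Hom C Z Y \<Longrightarrow> in_ideal (h \<cdot> c) \<Longrightarrow> in_ideal h"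
    "u \<in> Hom Q Z Y" "v \<in> Hom Q Z Y" "cmp Q u (q c) = cmp Q v (q c)"
  shows "u = v"
proof -
  obtain u0 where u0: "u0 \<in> Hom C Z Y" "u = q u0" using assms(4) by (rule quot_HomE)
  obtain v0 where v0: "v0 \<in> Hom C Z Y" "v = q v0" using assms(5) by (rule quot_HomE)
  have "q (u0 \<cdot> c) = q (v0 \<cdot> c)"
    using assms(6) quot_comp[OF assms(1) u0(1)] quot_comp[OF assms(1) v0(1)] u0(2) v0(2) by simp
  then have "in_ideal (u0 \<cdot> c \<ominus> v0 \<cdot> c)"
    using cls_eqD[OF comp_Hom[OF u0(1) assms(1)] comp_Hom[OF v0(1) assms(1)]] by simp
  then have "in_ideal (u0 \<ominus> v0)"
    using assms(3)[of "u0 \<ominus> v0"] comp_minus_left[OF u0(1) v0(1) assms(1)] u0 v0 by simp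
  then show ?thesis using cls_eqI[OF u0(1) v0(1)] u0 v0 by simp
qed

text \<open>Existence combines the weak universal properties of \<open>Cm_cone\<close> and
  \<open>heart_reflection\<close>; uniqueness is cancellation of the two deflations. They are handed
  out separately so that each can be pulled back on its own.\<close>

lemma quot_cokernel:
  assumes "f \<in> Hom C A B" "A \<in> heart" "B \<in> heart"
  obtains M m Z z where "deflation B m M" "deflation M z Z" "m \<in> Hom C B M" "z \<in> Hom C M Z"
    "Z \<in> heart" "is_cokernel Q (q f) (q (z \<cdot> m))"
proof -
  obtain M m where m: "M \<in> Cm" "deflation B m M" "m \<in> Hom C B M" "in_ideal (m \<cdot> f)"
    and mu: "\<And>Y g. g \<in> Hom C B Y \<Longrightarrow> in_ideal (g \<cdot> f) \<Longrightarrow> \<exists>h\<in>Hom C M Y. g = h \<cdot> m"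
    using Cm_cone[OF assms(1)] assms(2,3) by (metis IntD2)
  obtain Z z where z: "Z \<in> heart" "deflation M z Z" "z \<in> Hom C M Z"
    and zu: "\<And>Y g. Y \<in> Cp \<Longrightarrow> g \<in> Hom C M Y \<Longrightarrow> \<exists>h\<in>Hom C Z Y. g = h \<cdot> z"
    using heart_reflection[OF m(1)] by metis
  let ?c = "z \<cdot> m"
  have c: "?c \<in> Hom C B Z" using z(3) m(3) by blast
  have cq: "q ?c \<in> Hom Q B Z" using quot_HomI[OF c assms(3) z(1)] .
  note fdc = quot_dom_cod[OF assms(1)] and cdc = quot_dom_cod[OF c]
  have "in_ideal (?c \<cdot> f)"
    using comp_assoc[OF z(3) m(3) assms(1)]
      in_ideal_comp_left[OF m(4) comp_Hom[OF m(3) assms(1)] z(3)] by simp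
  then have cf: "cmp Q (q ?c) (q f) = zr Q A Z"
    using quot_comp[OF assms(1) c] cls_zero_iff[OF comp_Hom[OF c assms(1)]] by simp
  have ex: "\<exists>!u. u \<in> Hom Q Z Y \<and> cmp Q u (q ?c) = g"
    if g: "g \<in> Hom Q B Y" "cmp Q g (q f) = zr Q A Y" for g Y
  proof -
    obtain g0 where g0: "g0 \<in> Hom C B Y" "g = q g0" "Y \<in> heart"
      using g(1) by (rule quot_HomE)
    have "in_ideal (g0 \<cdot> f)"
      using g(2) quot_comp[OF assms(1) g0(1)] g0(2) cls_zero_iff[OF comp_Hom[OF g0(1) assms(1)]]
      by simp
    then obtain h where h: "h \<in> Hom C M Y" "g0 = h \<cdot> m" using mu[OF g0(1)] by blast
    obtain k where k: "k \<in> Hom C Z Y" "h = k \<cdot> z" using zu[OF _ h(1)] g0(3) by blast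
    have "k \<cdot> ?c = g0" using comp_assoc[OF k(1) z(3) m(3)] h(2) k(2) by simp
    then have "cmp Q (q k) (q ?c) = g" using quot_comp[OF c k(1)] g0(2) by simp
    moreover have "q k \<in> Hom Q Z Y" using quot_HomI[OF k(1) z(1) g0(3)] .
    moreover have "u = v" if "u \<in> Hom Q Z Y" "v \<in> Hom Q Z Y" "cmp Q u (q ?c) = cmp Q v (q ?c)" for u v
      using quot_cancel[OF c g0(3) _ that] deflation2_epi[OF m(2) z(2) m(3) z(3)] g0(3) by blast
    ultimately show ?thesis by metis
  qed
  have "is_cokernel Q (q f) (q ?c)"
    unfolding is_cokernel_def fdc cdc
  proof (intro conjI ballI impI)
    show "q ?c \<in> mor Q" using cq by (simp add: Hom_def)
    show "B = B" ..
    show "cmp Q (q ?c) (q f) = zr Q A Z" by (rule cf)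
    fix g assume "g \<in> mor Q" "dm Q g = B \<and> cmp Q g (q f) = zr Q A (cd Q g)"
    then show "\<exists>!u. u \<in> Hom Q Z (cd Q g) \<and> cmp Q u (q ?c) = g"
      by (intro ex) (auto simp: Hom_def)
  qed
  then show ?thesis using that m(2,3) z by blast
qed

lemma quot_cokernel_exists:
  assumes "A \<in> mor Q"
  shows "\<exists>c. is_cokernel Q A c"
proof -
  obtain f where "f \<in> Hom C (dm Q A) (cd Q A)" "A = q f" "dm Q A \<in> heart" "cd Q A \<in> heart"
    using assms by (rule quot_morE)
  then show ?thesis using quot_cokernel by metis
qed

lemma left_semi_abelian_quot: "left_semi_abelian Q"
  unfolding left_semi_abelian_def cokernel_morphism_def
proof (intro allI impI, elim conjE bexE)
  interpret Q: preadd_cat Q by standard (rule preadditive_quot)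
  fix \<alpha> \<beta> \<gamma> \<delta> \<phi>
  assume pb: "pullback_square Q \<alpha> \<beta> \<gamma> \<delta>" and \<phi>: "\<phi> \<in> mor Q" and ck: "is_cokernel Q \<phi> \<delta>"
  obtain f where f: "f \<in> Hom C (dm Q \<phi>) (cd Q \<phi>)" "\<phi> = q f" "dm Q \<phi> \<in> heart" "cd Q \<phi> \<in> heart"
    using \<phi> by (rule quot_morE)
  let ?A = "dm Q \<phi>" and ?B = "cd Q \<phi>" and ?P = "dm Q \<alpha>" and ?X = "cd Q \<alpha>" and ?D = "cd Q \<delta>"
  have sq: "\<alpha> \<in> Hom Q ?P ?X" "\<beta> \<in> Hom Q ?X ?D" "\<gamma> \<in> Hom Q ?P ?B" "\<delta> \<in> Hom Q ?B ?D"
    using pb ck unfolding pullback_square_def comm_square_def is_cokernel_def Hom_def by auto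
  have pbu: "\<exists>u\<in>Hom Q Y ?P. cmp Q \<alpha> u = x"
    if "x \<in> Hom Q Y ?X" "y \<in> Hom Q Y ?B" "cmp Q \<beta> x = cmp Q \<delta> y" for x y Y
  proof -
    have "\<exists>!u. u \<in> Hom Q (dm Q x) ?P \<and> cmp Q \<alpha> u = x \<and> cmp Q \<gamma> u = y"
      using pb[unfolded pullback_square_def, THEN conjunct2, rule_format, of x y]
        Q.HomD(1,2,3)[OF that(1)] Q.HomD(1,2,3)[OF that(2)] that(3)
        Q.HomD(2)[OF sq(2)] Q.HomD(2)[OF sq(4)] by simp
    then show ?thesis using Q.HomD(2)[OF that(1)] by blast
  qed
  \<comment> \<open>The given \<open>\<delta>\<close> is only known as some cokernel of
    \<open>\<phi>\<close>. A second cokernel of \<open>\<phi>\<close>, made of deflations, is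
    compared with it.\<close>
  obtain M m Z z where m: "deflation ?B m M" "m \<in> Hom C ?B M" and z: "deflation M z Z" "z \<in> Hom C M Z"
    and Z: "Z \<in> heart" and ck': "is_cokernel Q \<phi> (q (z \<cdot> m))"
    using quot_cokernel[OF f(1,3,4)] f(2) by metis
  let ?c = "z \<cdot> m"
  have c: "?c \<in> Hom C ?B Z" using z(2) m(2) by blast
  have cq: "q ?c \<in> Hom Q ?B Z" using quot_HomI[OF c f(4) Z] .
  note cdc = quot_dom_cod[OF c]
  have u1: "\<exists>!u. u \<in> Hom Q ?D Y \<and> cmp Q u \<delta> = g" if "g \<in> Hom Q ?B Y" "cmp Q g \<phi> = zr Q ?A Y" for g Y
    using ck[unfolded is_cokernel_def, THEN conjunct2, THEN conjunct2, THEN conjunct2,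
        rule_format, of g] Q.HomD(1,2,3)[OF that(1)] that(2) by simp
  have u2: "\<exists>!u. u \<in> Hom Q Z Y \<and> cmp Q u (q ?c) = g" if "g \<in> Hom Q ?B Y" "cmp Q g \<phi> = zr Q ?A Y" for g Y
    using ck'[unfolded is_cokernel_def cdc, THEN conjunct2, THEN conjunct2, THEN conjunct2,
        rule_format, of g] Q.HomD(1,2,3)[OF that(1)] that(2) by simp
  have z1: "cmp Q \<delta> \<phi> = zr Q ?A ?D" using ck unfolding is_cokernel_def by blast
  have z2: "cmp Q (q ?c) \<phi> = zr Q ?A Z" using ck' unfolding is_cokernel_def cdc by blast
  obtain \<theta> where \<theta>: "\<theta> \<in> Hom Q ?D Z" "cmp Q \<theta> \<delta> = q ?c" using u1[OF cq z2] by blast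
  obtain \<theta>' where \<theta>': "\<theta>' \<in> Hom Q Z ?D" "cmp Q \<theta>' (q ?c) = \<delta>" using u2[OF sq(4) z1] by blast
  have inv: "cmp Q \<theta>' \<theta> = idm Q ?D"
  proof -
    have "cmp Q (cmp Q \<theta>' \<theta>) \<delta> = \<delta>" using Q.comp_assoc[OF \<theta>'(1) \<theta>(1) sq(4)] \<theta>(2) \<theta>'(2) by simp
    moreover have "cmp Q (idm Q ?D) \<delta> = \<delta>" using Q.id_left[OF sq(4)] .
    ultimately show ?thesis
      using u1[OF sq(4) z1] Q.comp_Hom[OF \<theta>'(1) \<theta>(1)] Q.id_Hom[OF Q.HomD(5)[OF sq(4)]] by blast
  qed
  \<comment> \<open>Any representative in \<open>C\<close> of the vertical arrow, transported to the
    concrete cokernel object Z, can be pulled back along deflations.\<close>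
  obtain b where b: "b \<in> Hom C ?X Z" "cmp Q \<theta> \<beta> = q b" "?X \<in> heart"
    using Q.comp_Hom[OF \<theta>(1) sq(2)] by (rule quot_HomE)
  obtain A1 x1 y1 where d1: "deflation A1 x1 ?X" "x1 \<in> Hom C A1 ?X" "y1 \<in> Hom C A1 M" "z \<cdot> y1 = b \<cdot> x1"
    using deflation_pullback[OF z(1) b(1)] .
  obtain A2 x2 y2 where d2: "deflation A2 x2 A1" "x2 \<in> Hom C A2 A1" "y2 \<in> Hom C A2 ?B" "m \<cdot> y2 = y1 \<cdot> x2"
    using deflation_pullback[OF m(1) d1(3)] .
  \<comment> \<open>A2 -> A1 -> \<open>?X\<close> are deflations and \<open>?X\<close> is in the
    heart, so \<open>Cm\<close> passes back to A2, which then has a reflection R. Both maps out of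
    A2 end in the heart and descend to R.\<close>
  have "A2 \<in> Cm" using Cm_deflation[OF d2(1) Cm_deflation[OF d1(1)]] b(3) by simp
  then obtain R r where r: "R \<in> heart" "deflation A2 r R" "r \<in> Hom C A2 R"
    and ru: "\<And>Y g. Y \<in> Cp \<Longrightarrow> g \<in> Hom C A2 Y \<Longrightarrow> \<exists>h\<in>Hom C R Y. g = h \<cdot> r"
    using heart_reflection by metis
  have xx: "x1 \<cdot> x2 \<in> Hom C A2 ?X" using d1(2) d2(2) by blast
  obtain x where x: "x \<in> Hom C R ?X" "x1 \<cdot> x2 = x \<cdot> r" using ru[OF _ xx] b(3) by blast
  obtain y where y: "y \<in> Hom C R ?B" "y2 = y \<cdot> r" using ru[OF _ d2(3)] f(4) by blast
  \<comment> \<open>This equality is strict in \<open>C\<close>. The deflation r can be cancelled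
    only modulo W, which suffices to get a commuting square in the quotient.\<close>
  have "(?c \<cdot> y) \<cdot> r = (b \<cdot> x) \<cdot> r"
  proof -
    have "(?c \<cdot> y) \<cdot> r = ?c \<cdot> y2" using comp_assoc[OF c y(1) r(3)] y(2) by simp
    also have "\<dots> = z \<cdot> (y1 \<cdot> x2)" using comp_assoc[OF z(2) m(2) d2(3)] d2(4) by simp
    also have "\<dots> = (b \<cdot> x1) \<cdot> x2" using comp_assoc[OF z(2) d1(3) d2(2)] d1(4) by simp
    also have "\<dots> = b \<cdot> (x \<cdot> r)" using comp_assoc[OF b(1) d1(2) d2(2)] x(2) by simp
    also have "\<dots> = (b \<cdot> x) \<cdot> r" using comp_assoc[OF b(1) x(1) r(3)] .
    finally show ?thesis .
  qed
  moreover have cy: "?c \<cdot> y \<in> Hom C R Z" and bx: "b \<cdot> x \<in> Hom C R Z" using c y(1) b(1) x(1) by blast+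
  ultimately have "(?c \<cdot> y \<ominus> b \<cdot> x) \<cdot> r = zr C A2 Z"
    using comp_minus_left[OF cy bx r(3)] plus_neg[OF comp_Hom[OF bx r(3)]] by simp
  then have "in_ideal (?c \<cdot> y \<ominus> b \<cdot> x)"
    using deflation_epi[OF r(2), of Z "?c \<cdot> y \<ominus> b \<cdot> x"] Z cy bx
      in_ideal_zero[OF HomD(4)[OF r(3)] HomD(5)[OF bx]] by simp
  then have qq: "cmp Q (q ?c) (q y) = cmp Q (q b) (q x)"
    using cls_eqI[OF cy bx] quot_comp[OF y(1) c] quot_comp[OF x(1) b(1)] by simp
  have qx: "q x \<in> Hom Q R ?X" and qy: "q y \<in> Hom Q R ?B"
    using quot_HomI[OF x(1) r(1) b(3)] quot_HomI[OF y(1) r(1) f(4)] by auto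
  have "cmp Q \<delta> (q y) = cmp Q \<theta>' (cmp Q (q ?c) (q y))"
    using Q.comp_assoc[OF \<theta>'(1) cq qy] \<theta>'(2) by simp
  also have "\<dots> = cmp Q \<theta>' (cmp Q \<theta> (cmp Q \<beta> (q x)))"
    using qq b(2) Q.comp_assoc[OF \<theta>(1) sq(2) qx] by simp
  also have "\<dots> = cmp Q \<beta> (q x)"
    using Q.comp_assoc[OF \<theta>'(1) \<theta>(1) Q.comp_Hom[OF sq(2) qx]] inv
      Q.id_left[OF Q.comp_Hom[OF sq(2) qx]] by simp
  finally obtain u where u: "u \<in> Hom Q R ?P" "cmp Q \<alpha> u = q x" using pbu[OF qx qy] by auto
  \<comment> \<open>x r = x1 x2 is a composite of deflations, so x inherits the cancellation
    property. Since \<open>q x\<close> factors through \<open>\<alpha>\<close>, so does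
    \<open>\<alpha>\<close>.\<close>
  have x_epi: "in_ideal h" if "Y \<in> Cp" "h \<in> Hom C ?X Y" "in_ideal (h \<cdot> x)" for h Y
  proof -
    have "h \<cdot> (x1 \<cdot> x2) = (h \<cdot> x) \<cdot> r" using comp_assoc[OF that(2) x(1) r(3)] x(2) by simp
    then have "in_ideal (h \<cdot> (x1 \<cdot> x2))"
      using in_ideal_comp_right[OF that(3) comp_Hom[OF that(2) x(1)] r(3)] by simp
    then show ?thesis using deflation2_epi[OF d2(1) d1(1) d2(2) d1(2) that(1,2)] by simp
  qed
  show "epi Q \<alpha>"
    unfolding epi_def
  proof (intro conjI allI impI)
    show "\<alpha> \<in> mor Q" using sq(1) by (simp add: Hom_def)
    fix g h
    assume gh: "g \<in> mor Q \<and> h \<in> mor Q \<and> dm Q g = ?X \<and> dm Q h = ?X \<and> cd Q g = cd Q h \<and>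
      cmp Q g \<alpha> = cmp Q h \<alpha>"
    then have g: "g \<in> Hom Q ?X (cd Q g)" and h: "h \<in> Hom Q ?X (cd Q g)" by (auto simp: Hom_def)
    have Y: "cd Q g \<in> heart" using Q.HomD(5)[OF g] by simp
    have "cmp Q g (q x) = cmp Q h (q x)"
      using gh u(2) Q.comp_assoc[OF g sq(1) u(1)] Q.comp_assoc[OF h sq(1) u(1)] by simp
    then show "g = h" using quot_cancel[OF x(1) Y _ g h] x_epi Y by blast
  qed
qed

end

text \<open>Kernels, right semi-abelianness and the \<open>Cp\<close> half of additivity are read
  off from the locale interpreted in the opposite category, whose quotient is exactly
  \<open>op_cat Q\<close>.\<close>

theorem (in twin_pair) semi_abelian_quot: "semi_abelian Q"
proof -
  interpret op: twin_pair "op_cat C" "\<lambda>X f Y g Z. E Z g Y f X" V' V U T S S' W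
    by (rule opposite)
  have Cp: "op.Cm = Cp" and Cm: "op.Cp = Cm" by (rule ext_star_op)+
  have heart: "op.heart = heart" unfolding Cp Cm by blast
  have opQ: "op.Q = op_cat Q" unfolding heart by (rule ideal_quotient_op_cat)
  have "additive Q"
  proof (rule additive_quot)
    show "\<exists>Z\<in>heart. zero_obj C Z"
      using W_zero Cm_zero op.Cm_zero unfolding Cp by auto
    show "B \<in> heart" if "X \<in> heart" "Y \<in> heart" "is_biprod C X Y B" for X Y B
      using Cm_biprod[OF that(3)] op.Cm_biprod[of X Y B] that unfolding Cp by auto
  qed
  moreover have "\<exists>k. is_kernel Q f k" if "f \<in> mor Q" for f
    using op.quot_cokernel_exists[of f] that unfolding opQ by simp
  moreover have "right_semi_abelian Q"
    using op.left_semi_abelian_quot unfolding opQ right_semi_abelian_iff .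
  ultimately show ?thesis
    unfolding semi_abelian_def preabelian_def
    using quot_cokernel_exists left_semi_abelian_quot by blast
qed

section \<open>Triangulated categories\<close>

locale tri_cat =
  fixes C :: "('o,'m,'z) tricat_scheme"
  assumes tri: "triangulated C"

sublocale tri_cat \<subseteq> additive_cat C
  by (rule additive_catI) (use tri in \<open>simp add: triangulated_def\<close>)

context tri_cat
begin

lemmas tri_unfolded = tri[unfolded triangulated_def, THEN conjunct2]
lemmas shift_axioms = tri_unfolded[THEN conjunct1]
lemmas dtri_pretriangle = tri_unfolded[THEN conjunct2, THEN conjunct1, rule_format]
lemmas dtri_iso = tri_unfolded[THEN conjunct2, THEN conjunct2, THEN conjunct1, rule_format]
lemmas dtri_id = tri_unfolded[THEN conjunct2, THEN conjunct2, THEN conjunct2, THEN conjunct1,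
  rule_format]
lemmas dtri_cone = tri_unfolded[THEN conjunct2, THEN conjunct2, THEN conjunct2, THEN conjunct2,
  THEN conjunct1, rule_format]
lemmas dtri_rotate = tri_unfolded[THEN conjunct2, THEN conjunct2, THEN conjunct2, THEN conjunct2,
  THEN conjunct2, THEN conjunct1, rule_format]
lemmas dtri_rotate_back = tri_unfolded[THEN conjunct2, THEN conjunct2, THEN conjunct2, THEN conjunct2,
  THEN conjunct2, THEN conjunct2, THEN conjunct1, rule_format]
lemmas dtri_morphism = tri_unfolded[THEN conjunct2, THEN conjunct2, THEN conjunct2, THEN conjunct2,
  THEN conjunct2, THEN conjunct2, THEN conjunct2, THEN conjunct1, rule_format]
lemmas dtri_octahedron = tri_unfolded[THEN conjunct2, THEN conjunct2, THEN conjunct2, THEN conjunct2,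
  THEN conjunct2, THEN conjunct2, THEN conjunct2, THEN conjunct2, rule_format]

lemma shift_obj [simp, intro]: "X \<in> obj C \<Longrightarrow> sho C X \<in> obj C"
  using shift_axioms by (simp add: shift_autoequivalence_def)

lemma shift_Hom [simp, intro]: "f \<in> Hom C X Y \<Longrightarrow> shm C f \<in> Hom C (sho C X) (sho C Y)"
  using shift_axioms unfolding shift_autoequivalence_def by blast

lemma shift_id: "X \<in> obj C \<Longrightarrow> shm C (idm C X) = idm C (sho C X)"
  using shift_axioms unfolding shift_autoequivalence_def by blast

lemma shift_comp:
  "g \<in> Hom C Y Z \<Longrightarrow> f \<in> Hom C X Y \<Longrightarrow> shm C (g \<cdot> f) = shm C g \<cdot> shm C f"
  using shift_axioms unfolding shift_autoequivalence_def Hom_def by auto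

lemma shift_plus:
  "g \<in> Hom C X Y \<Longrightarrow> f \<in> Hom C X Y \<Longrightarrow> shm C (g \<oplus> f) = shm C g \<oplus> shm C f"
  using shift_axioms unfolding shift_autoequivalence_def Hom_def by auto

lemma shift_faithful:
  "f \<in> Hom C X Y \<Longrightarrow> g \<in> Hom C X Y \<Longrightarrow> shm C f = shm C g \<Longrightarrow> f = g"
  using shift_axioms HomD(4,5)[of f X Y] unfolding shift_autoequivalence_def inj_on_def by blast

lemma shift_full:
  assumes "g \<in> Hom C (sho C X) (sho C Y)" "X \<in> obj C" "Y \<in> obj C"
  obtains f where "f \<in> Hom C X Y" "g = shm C f"
proof -
  have "shm C ` Hom C X Y = Hom C (sho C X) (sho C Y)"
    using shift_axioms assms(2,3) unfolding shift_autoequivalence_def by blast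
  then show ?thesis using assms(1) that by blast
qed

lemma shift_zero:
  assumes "X \<in> obj C" "Y \<in> obj C"
  shows "shm C (zr C X Y) = zr C (sho C X) (sho C Y)"
proof -
  have z: "zr C X Y \<in> Hom C X Y" using assms by blast
  have "shm C (zr C X Y) \<oplus> shm C (zr C X Y) = shm C (zr C X Y)"
    using shift_plus[OF z z] plus_zero[OF z] by simp
  then show ?thesis
    using plus_cancel[OF shift_Hom[OF z] shift_Hom[OF z] zero_Hom] plus_zero[OF shift_Hom[OF z]] assms
    by simp
qed

lemma shift_neg:
  assumes "f \<in> Hom C X Y"
  shows "shm C (ng C f) = ng C (shm C f)"
  by (rule neg_unique[of _ "sho C X" "sho C Y"])
    (use assms shift_plus[OF assms neg_Hom[OF assms]] shift_zero HomD(4,5)[OF assms] in simp_all)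

section \<open>Triangles with named vertices and their exactness\<close>

definition dist :: "'o \<Rightarrow> 'm \<Rightarrow> 'o \<Rightarrow> 'm \<Rightarrow> 'o \<Rightarrow> 'm \<Rightarrow> bool" where
  "dist X f Y g Z h \<longleftrightarrow> (f,g,h) \<in> dtri C \<and> f \<in> Hom C X Y \<and> g \<in> Hom C Y Z \<and> h \<in> Hom C Z (sho C X)"

lemma distD:
  assumes "dist X f Y g Z h"
  shows "(f,g,h) \<in> dtri C" "f \<in> Hom C X Y" "g \<in> Hom C Y Z" "h \<in> Hom C Z (sho C X)"
  using assms by (auto simp: dist_def)

lemma dtri_dist:
  assumes "(f,g,h) \<in> dtri C" "f \<in> Hom C X Y"
  shows "dist X f Y g (cd C g) h"
proof -
  have "pretriangle C f g h" using dtri_pretriangle assms(1) .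
  then show ?thesis using assms unfolding dist_def pretriangle_def by (auto simp: Hom_def)
qed

lemma dist_cone:
  assumes "f \<in> Hom C X Y"
  obtains g Z h where "dist X f Y g Z h"
proof -
  obtain g h where "(f,g,h) \<in> dtri C"
    using dtri_cone[OF HomD(1)[OF assms]] by blast
  then show ?thesis using that dtri_dist assms by blast
qed

lemma dist_rotate:
  assumes "dist X f Y g Z h"
  shows "dist Y g Z h (sho C X) (ng C (shm C f))"
proof -
  have "(g, h, ng C (shm C f)) \<in> dtri C" using dtri_rotate[OF distD(1)[OF assms]] .
  then show ?thesis using distD[OF assms] unfolding dist_def by simp
qed

lemma dist_rotate_back:
  assumes "dist Y g Z h (sho C X) (ng C (shm C f))" "f \<in> Hom C X Y"
  shows "dist X f Y g Z h"
proof -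
  have "pretriangle C f g h"
    using distD[OF assms(1)] assms(2) unfolding pretriangle_def Hom_def by auto
  then have "(f, g, h) \<in> dtri C" using dtri_rotate_back distD(1)[OF assms(1)] by blast
  then show ?thesis using distD[OF assms(1)] assms(2) unfolding dist_def by simp
qed

lemma dist_iso:
  assumes "dist X f Y g Z h" "f' \<in> Hom C X' Y'" "g' \<in> Hom C Y' Z'" "h' \<in> Hom C Z' (sho C X')"
    "a \<in> Hom C X X'" "b \<in> Hom C Y Y'" "c \<in> Hom C Z Z'" "iso C a" "iso C b" "iso C c"
    "f' \<cdot> a = b \<cdot> f" "g' \<cdot> b = c \<cdot> g" "h' \<cdot> c = shm C a \<cdot> h"
  shows "dist X' f' Y' g' Z' h'"
proof -
  have "pretriangle C f' g' h'"
    using assms(2-4) unfolding pretriangle_def Hom_def by auto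
  then have "(f',g',h') \<in> dtri C"
    using HomD(2,3)[OF assms(2)] HomD(3)[OF assms(3)] assms(5-)
      HomD(2,3)[OF distD(2)[OF assms(1)]] HomD(3)[OF distD(3)[OF assms(1)]] distD(1)[OF assms(1)]
    by (intro dtri_iso[of f g h f' g' h' a b c]) simp
  then show ?thesis using assms(2-4) unfolding dist_def by simp
qed

lemma dist_id:
  assumes "X \<in> obj C"
  obtains Z where "zero_obj C Z" "dist X (idm C X) X (zr C X Z) Z (zr C Z (sho C X))"
proof -
  obtain Z where Z: "zero_obj C Z" "(idm C X, zr C X Z, zr C Z (sho C X)) \<in> dtri C"
    using dtri_id[OF assms] by blast
  then have "Z \<in> obj C" by (simp add: zero_obj_def)
  then show ?thesis using that Z assms unfolding dist_def by simp
qed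

lemma dist_morphism:
  assumes "dist X f Y g Z h" "dist X' f' Y' g' Z' h'" "a \<in> Hom C X X'" "b \<in> Hom C Y Y'"
    "b \<cdot> f = f' \<cdot> a"
  obtains c where "c \<in> Hom C Z Z'" "c \<cdot> g = g' \<cdot> b" "h' \<cdot> c = shm C a \<cdot> h"
proof -
  have "\<exists>c\<in>Hom C Z Z'. c \<cdot> g = g' \<cdot> b \<and> h' \<cdot> c = shm C a \<cdot> h"
    using distD(1)[OF assms(1)] distD(1)[OF assms(2)] assms(3-)
      HomD(2,3)[OF distD(2)[OF assms(1)]] HomD(3)[OF distD(3)[OF assms(1)]]
      HomD(2,3)[OF distD(2)[OF assms(2)]] HomD(3)[OF distD(3)[OF assms(2)]]
      dtri_morphism[of f g h f' g' h' a b] by simp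
  then show ?thesis using that by blast
qed

lemma dist_octahedron:
  assumes "dist X f Y f' Z' f''" "dist Y g Z g' X' g''" "dist X (g \<cdot> f) Z h' Y' h''"
  obtains u v where "dist Z' u Y' v X' (shm C f' \<cdot> g'')"
proof -
  have "\<exists>u v. u \<in> Hom C Z' Y' \<and> v \<in> Hom C Y' X' \<and> (u, v, shm C f' \<cdot> g'') \<in> dtri C"
    using distD(1)[OF assms(1)] distD(1)[OF assms(2)] distD(1)[OF assms(3)]
      HomD(3)[OF distD(2)[OF assms(1)]] HomD(3)[OF distD(3)[OF assms(1)]]
      HomD(2)[OF distD(2)[OF assms(2)]] HomD(3)[OF distD(3)[OF assms(2)]]
      HomD(3)[OF distD(3)[OF assms(3)]]
      dtri_octahedron[of f f' f'' g g' g'' h' h''] by auto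
  then obtain u v where uv: "u \<in> Hom C Z' Y'" "v \<in> Hom C Y' X'" "(u, v, shm C f' \<cdot> g'') \<in> dtri C"
    by blast
  have "shm C f' \<cdot> g'' \<in> Hom C X' (sho C Z')"
    using shift_Hom[OF distD(3)[OF assms(1)]] distD(4)[OF assms(2)] by blast
  then show ?thesis using that uv unfolding dist_def by blast
qed

lemma isoI:
  assumes "f \<in> Hom C X Y" "g \<in> Hom C Y X" "g \<cdot> f = idm C X" "f \<cdot> g = idm C Y"
  shows "iso C f"
  unfolding iso_def using assms HomD(1,2,3)[OF assms(1)] by auto

lemma isoE:
  assumes "iso C f" "f \<in> Hom C X Y"
  obtains g where "g \<in> Hom C Y X" "g \<cdot> f = idm C X" "f \<cdot> g = idm C Y" "iso C g"
proof -
  obtain g where "g \<in> Hom C Y X" "g \<cdot> f = idm C X" "f \<cdot> g = idm C Y"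
    using assms HomD(2,3)[OF assms(2)] unfolding iso_def by auto
  then show ?thesis using that isoI assms(2) by blast
qed

lemma iso_id: "X \<in> obj C \<Longrightarrow> iso C (idm C X)"
  using id_left[OF id_Hom] by (intro isoI[of _ X X "idm C X"]) simp_all

lemma isomorphic_sym: "isomorphic C X Y \<Longrightarrow> isomorphic C Y X"
  unfolding isomorphic_def by (metis isoE)

text \<open>The pair (identity, f) maps the triangle X -> X -> 0 into the given one; the completed
  third arrow shows that g f passes through a zero object.\<close>

lemma dist_comp_zero:
  assumes "dist X f Y g Z h"
  shows "g \<cdot> f = zr C X Z"
proof -
  note d = distD[OF assms]
  obtain N where N: "zero_obj C N" "dist X (idm C X) X (zr C X N) N (zr C N (sho C X))"
    using dist_id[OF HomD(4)[OF d(2)]] .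
  obtain c where c: "c \<in> Hom C N Z" "c \<cdot> zr C X N = g \<cdot> f"
    using dist_morphism[OF N(2) assms id_Hom[OF HomD(4)[OF d(2)]] d(2)] by blast
  then show ?thesis using comp_zero[OF c(1) HomD(4)[OF d(2)]] by simp
qed

text \<open>Completion produces a third arrow, while a first arrow A -> X is wanted. So both
  triangles are rotated once, the completion A[1] -> X[1] is found, and full faithfulness removes
  the shift.\<close>

lemma dist_weak_kernel:
  assumes "dist X f Y g Z h" "u \<in> Hom C A Y" "g \<cdot> u = zr C A Z"
  shows "\<exists>v\<in>Hom C A X. u = f \<cdot> v"
proof -
  note d = distD[OF assms(1)]
  note A = HomD(4)[OF assms(2)]
  obtain N where N: "zero_obj C N" "dist A (idm C A) A (zr C A N) N (zr C N (sho C A))"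
    using dist_id[OF A] .
  have No: "N \<in> obj C" using N(1) by (simp add: zero_obj_def)
  have n: "zr C N Z \<in> Hom C N Z" using No HomD(5)[OF d(3)] by blast
  have "zr C N Z \<cdot> zr C A N = g \<cdot> u" using comp_zero[OF n A] assms(3) by simp
  then obtain c where c: "c \<in> Hom C (sho C A) (sho C X)"
    "ng C (shm C f) \<cdot> c = shm C u \<cdot> ng C (shm C (idm C A))"
    using dist_morphism[OF dist_rotate[OF N(2)] dist_rotate[OF assms(1)] assms(2) n] by blast
  obtain v where v: "v \<in> Hom C A X" "c = shm C v" using shift_full[OF c(1) A HomD(4)[OF d(2)]] .
  have "ng C (shm C f \<cdot> c) = ng C (shm C u)"
    using c neg_comp[OF shift_Hom[OF d(2)] c(1)] shift_id[OF A] A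
      comp_neg[OF shift_Hom[OF assms(2)] id_Hom[OF shift_obj[OF A]]] id_right[OF shift_Hom[OF assms(2)]]
    by simp
  then have "shm C f \<cdot> c = shm C u"
    using neg_neg[OF comp_Hom[OF shift_Hom[OF d(2)] c(1)]] neg_neg[OF shift_Hom[OF assms(2)]] by metis
  then have "shm C (f \<cdot> v) = shm C u" using shift_comp[OF d(2) v(1)] v(2) by simp
  then have "f \<cdot> v = u" using shift_faithful[OF comp_Hom[OF d(2) v(1)] assms(2)] by simp
  then show ?thesis using v(1) by blast
qed

text \<open>The natural target is the triangle 0 -> A -> A, obtained here in shifted form by
  rotating A -> A -> 0 forward twice; the given triangle is rotated three times to match.\<close>

lemma dist_weak_cokernel:
  assumes "dist X f Y g Z h" "u \<in> Hom C Y A" "u \<cdot> f = zr C X A"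
  shows "\<exists>v\<in>Hom C Z A. u = v \<cdot> g"
proof -
  note d = distD[OF assms(1)]
  note A = HomD(5)[OF assms(2)] and X = HomD(4)[OF d(2)]
  obtain N where N: "zero_obj C N" "dist A (idm C A) A (zr C A N) N (zr C N (sho C A))"
    using dist_id[OF A] .
  have No: "N \<in> obj C" using N(1) by (simp add: zero_obj_def)
  let ?n = "zr C (sho C X) N" and ?u = "shm C u" and ?g = "shm C g" and ?f = "shm C f"
  have n: "?n \<in> Hom C (sho C X) N" using No X by blast
  note s = shift_Hom[OF d(2)] shift_Hom[OF d(3)] shift_Hom[OF assms(2)]
  have "?u \<cdot> ng C ?f = zr C N (sho C A) \<cdot> ?n"
    unfolding comp_neg[OF s(3,1)] shift_comp[OF assms(2) d(2), symmetric] assms(3) shift_zero[OF X A]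
    using X A zero_comp[OF n, of "sho C A"] by simp
  then obtain c where c: "c \<in> Hom C (sho C Z) (sho C A)"
    "c \<cdot> ng C ?g = ng C (shm C (idm C A)) \<cdot> ?u"
    using dist_morphism[OF dist_rotate[OF dist_rotate[OF dist_rotate[OF assms(1)]]]
        dist_rotate[OF dist_rotate[OF N(2)]] n s(3)] by blast
  obtain v where v: "v \<in> Hom C Z A" "c = shm C v" using shift_full[OF c(1) HomD(5)[OF d(3)] A] .
  have "ng C (c \<cdot> ?g) = ng C ?u"
    using c comp_neg[OF c(1) s(2)] shift_id[OF A] A
      neg_comp[OF id_Hom[OF shift_obj[OF A]] s(3)] id_left[OF s(3)] by simp
  then have "c \<cdot> ?g = ?u" using neg_neg[OF comp_Hom[OF c(1) s(2)]] neg_neg[OF s(3)] by metis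
  then have "shm C (v \<cdot> g) = ?u" using shift_comp[OF v(1) d(3)] v(2) by simp
  then have "v \<cdot> g = u" using shift_faithful[OF comp_Hom[OF v(1) d(3)] assms(2)] by simp
  then show ?thesis using v(1) by blast
qed

text \<open>Isomorphic to the given triangle via (id, -id, id).\<close>

lemma dist_neg:
  assumes "dist X f Y g Z h"
  shows "dist X (ng C f) Y (ng C g) Z h"
proof -
  note d = distD[OF assms]
  note o = HomD(4)[OF d(2)] HomD(4)[OF d(3)] HomD(4)[OF d(4)]
  let ?m = "ng C (idm C Y)"
  have i: "idm C Y \<in> Hom C Y Y" using o by blast
  have m: "?m \<in> Hom C Y Y" using i by blast
  have mm: "?m \<cdot> ?m = idm C Y"
    using neg_comp[OF i m] id_left[OF m] neg_neg[OF i] by simp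
  have "ng C f \<cdot> idm C X = ?m \<cdot> f"
    using neg_comp[OF i d(2)] d(2) id_right[OF neg_Hom[OF d(2)]] by simp
  moreover have "ng C g \<cdot> ?m = idm C Z \<cdot> g"
    using comp_neg[OF neg_Hom[OF d(3)] i] id_right[OF neg_Hom[OF d(3)]] neg_neg[OF d(3)] d(3) by simp
  moreover have "h \<cdot> idm C Z = shm C (idm C X) \<cdot> h"
    using shift_id[OF o(1)] d(4) by simp
  ultimately show ?thesis
    using dist_iso[OF assms neg_Hom[OF d(2)] neg_Hom[OF d(3)] d(4) id_Hom[OF o(1)] m id_Hom[OF o(3)]]
      iso_id o isoI[OF m m mm mm] by blast
qed

text \<open>Three backward rotations. Each needs its last arrow in the form
  \<open>ng C (shm C _)\<close>, so the first two arrows are negated by \<open>dist_neg\<close> and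
  the third is written as -(-t)[1].\<close>

lemma dist_unshift:
  assumes "dist (sho C X) (shm C p) (sho C Y) (shm C r) (sho C Z) w" "p \<in> Hom C X Y" "r \<in> Hom C Y Z"
  shows "\<exists>h. dist X p Y r Z h"
proof -
  note o = HomD(4,5)[OF assms(2)] HomD(5)[OF assms(3)]
  obtain t where t: "t \<in> Hom C Z (sho C X)" "w = shm C t"
    using shift_full[OF distD(4)[OF assms(1)]] o by blast
  have "w = ng C (shm C (ng C t))"
    using shift_neg[OF t(1)] neg_neg[OF shift_Hom[OF t(1)]] t(2) by simp
  then have "dist (sho C X) (ng C (shm C p)) (sho C Y) (ng C (shm C r)) (sho C Z) (ng C (shm C (ng C t)))"
    using dist_neg[OF assms(1)] by simp
  then have "dist Z (ng C t) (sho C X) (ng C (shm C p)) (sho C Y) (ng C (shm C r))"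
    using dist_rotate_back neg_Hom[OF t(1)] by blast
  then have "dist Y r Z (ng C t) (sho C X) (ng C (shm C p))"
    using dist_rotate_back assms(3) by blast
  then show ?thesis using dist_rotate_back assms(2) by blast
qed

text \<open>Backward rotation when the third vertex is a shift only up to isomorphism: replace K by
  the actual shift of X, then use fullness. The rotation sign is absorbed by taking -e.\<close>

lemma dist_unrotate:
  assumes "dist Y m Z n K h" "isomorphic C (sho C X) K" "X \<in> obj C"
  shows "\<exists>e k. dist X e Y m Z k"
proof -
  note d = distD[OF assms(1)]
  obtain c where c: "c \<in> Hom C (sho C X) K" "iso C c" using assms(2) unfolding isomorphic_def by blast
  obtain b where b: "b \<in> Hom C K (sho C X)" "b \<cdot> c = idm C (sho C X)" "c \<cdot> b = idm C K" "iso C b"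
    using isoE[OF c(2,1)] .
  note Y = HomD(4)[OF d(2)] HomD(5)[OF d(2)]
  have hc: "h \<cdot> c \<in> Hom C (sho C X) (sho C Y)" and bn: "b \<cdot> n \<in> Hom C Z (sho C X)"
    using d(3,4) c(1) b(1) by blast+
  have "(h \<cdot> c) \<cdot> b = shm C (idm C Y) \<cdot> h"
    using comp_assoc[OF d(4) c(1) b(1)] b(3) d(4) shift_id[OF Y(1)] by simp
  then have r: "dist Y m Z (b \<cdot> n) (sho C X) (h \<cdot> c)"
    using dist_iso[OF assms(1) d(2) bn hc id_Hom[OF Y(1)] id_Hom[OF Y(2)] b(1)]
      iso_id[OF Y(1)] iso_id[OF Y(2)] b(4) d(2) bn by simp
  obtain e where e: "e \<in> Hom C X Y" "h \<cdot> c = shm C e" using shift_full[OF hc assms(3) Y(1)] .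
  have "h \<cdot> c = ng C (shm C (ng C e))"
    using shift_neg[OF e(1)] neg_neg[OF shift_Hom[OF e(1)]] e(2) by simp
  then show ?thesis using r dist_rotate_back[of Y m Z "b \<cdot> n" X "ng C e"] e(1) by auto
qed

lemma shift_ess_surj:
  assumes "Y \<in> obj C"
  obtains X where "X \<in> obj C" "isomorphic C (sho C X) Y"
  using assms shift_axioms unfolding shift_autoequivalence_def by blast

lemma dist_cocone:
  assumes "g \<in> Hom C Y Z"
  shows "\<exists>f X h. dist X f Y g Z h"
proof -
  obtain n K k where d: "dist Y g Z n K k" using dist_cone[OF assms] .
  obtain X where "X \<in> obj C" "isomorphic C (sho C X) K"
    using shift_ess_surj[OF HomD(5)[OF distD(3)[OF d]]] .
  then show ?thesis using dist_unrotate[OF d] by blast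
qed

text \<open>The octahedral axiom applied to y, c and c y, whose cones are the shifts of X, B and A,
  followed by \<open>dist_unshift\<close>.\<close>

lemma dist_octahedron':
  assumes "dist X x Y y Z h1" "dist B b Z c D h2" "dist A d Y (c \<cdot> y) D h3"
  shows "\<exists>u v h. dist X u A v B h"
proof -
  note r = dist_rotate[OF assms(1)] dist_rotate[OF assms(2)] dist_rotate[OF assms(3)]
  obtain u v where uv: "dist (sho C X) u (sho C A) v (sho C B) (shm C h1 \<cdot> ng C (shm C b))"
    using dist_octahedron[OF r] .
  note o = HomD(4)[OF distD(2)[OF assms(1)]] HomD(4)[OF distD(2)[OF assms(2)]]
    HomD(4)[OF distD(2)[OF assms(3)]]
  obtain p where p: "p \<in> Hom C X A" "u = shm C p" using shift_full[OF distD(2)[OF uv] o(1,3)] .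
  obtain t where t: "t \<in> Hom C A B" "v = shm C t" using shift_full[OF distD(3)[OF uv] o(3,2)] .
  show ?thesis using dist_unshift[OF _ p(1) t(1)] uv p(2) t(2) by blast
qed

text \<open>\<open>subcat\<close> speaks of biproduct summands, so a complement of X is needed: the
  cocone K of the split epimorphism r. As h r = 0 and r s = 1, the connecting map h is zero and the
  triangle splits.\<close>

lemma subcat_retract:
  assumes "subcat C D" "B \<in> D" "s \<in> Hom C X B" "r \<in> Hom C B X" "r \<cdot> s = idm C X"
  shows "X \<in> D"
proof -
  note o = HomD(4,5)[OF assms(3)]
  obtain k K h where d: "dist K k B r X h" using dist_cocone[OF assms(4)] by blast
  note dH = distD[OF d]
  note Ko = HomD(4)[OF dH(2)]
  have "h \<cdot> r = zr C B (sho C K)" using dist_comp_zero[OF dist_rotate[OF d]] .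
  then have h0: "h = zr C X (sho C K)"
    using comp_assoc[OF dH(4) assms(4,3)] assms(5) id_right[OF dH(4)] zero_comp[OF assms(3)] Ko by simp
  \<comment> \<open>If k v = 0, the shift of v factors through h, which vanishes.\<close>
  have mono: "v = zr C A K" if v: "v \<in> Hom C A K" "k \<cdot> v = zr C A B" for v A
  proof -
    note A = HomD(4)[OF v(1)]
    have "ng C (shm C k) \<cdot> shm C v = zr C (sho C A) (sho C B)"
      unfolding neg_comp[OF shift_Hom[OF dH(2)] shift_Hom[OF v(1)]]
        shift_comp[OF dH(2) v(1), symmetric] v(2) shift_zero[OF A o(2)]
      using A o by simp
    then obtain w where "w \<in> Hom C (sho C A) X" "shm C v = h \<cdot> w"
      using dist_weak_kernel[OF dist_rotate[OF dist_rotate[OF d]] shift_Hom[OF v(1)]] by blast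
    then have "shm C v = shm C (zr C A K)"
      using h0 zero_comp[of w "sho C A" X "sho C K"] shift_zero[OF A Ko] Ko by simp
    then show ?thesis using shift_faithful[OF v(1) zero_Hom[OF A Ko]] by simp
  qed
  \<comment> \<open>The idempotent complementary to s r; it factors as k p, and p becomes the
    projection onto K.\<close>
  let ?e = "idm C B \<ominus> s \<cdot> r"
  have i: "idm C B \<in> Hom C B B" using o by blast
  have sr: "s \<cdot> r \<in> Hom C B B" using assms(3,4) by blast
  have eH: "?e \<in> Hom C B B" using i sr by simp
  have "r \<cdot> ?e = zr C B X"
    using comp_minus_right[OF assms(4) i sr] comp_assoc[OF assms(4,3,4)] assms(4,5) by simp
  then obtain p where p: "p \<in> Hom C B K" "?e = k \<cdot> p" using dist_weak_kernel[OF d eH] by blast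
  have es: "?e \<cdot> s = zr C X B"
    using comp_minus_left[OF i sr assms(3)] comp_assoc[OF assms(3,4,3)] assms(3,5) by simp
  have rk: "r \<cdot> k = zr C K X" using dist_comp_zero[OF d] .
  have ek: "?e \<cdot> k = k"
    unfolding comp_minus_left[OF i sr dH(2)] comp_assoc[OF assms(3,4) dH(2), symmetric] rk
    using dH(2) comp_zero[OF assms(3) Ko] by simp
  have ps: "p \<cdot> s = zr C X K"
    using mono[OF comp_Hom[OF p(1) assms(3)]] comp_assoc[OF dH(2) p(1) assms(3)] p(2) es by simp
  have iK: "idm C K \<in> Hom C K K" using Ko by blast
  have pk: "p \<cdot> k \<in> Hom C K K" using p(1) dH(2) by blast
  have "k \<cdot> (p \<cdot> k \<ominus> idm C K) = zr C K B"
    using comp_minus_right[OF dH(2) pk iK] comp_assoc[OF dH(2) p(1) dH(2)] p(2) ek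
      id_right[OF dH(2)] plus_neg[OF dH(2)] by simp
  then have "p \<cdot> k \<ominus> idm C K = zr C K K" using mono[of "p \<cdot> k \<ominus> idm C K" K] pk iK by simp
  then have pk1: "p \<cdot> k = idm C K" using minus_eq_zero[OF pk iK] by simp
  have "k \<cdot> p \<oplus> s \<cdot> r = idm C B" using minus_plus_cancel[OF i sr] p(2) by simp
  then have "is_biprod C K X B"
    unfolding is_biprod_def using o dH(2) assms(3-5) p(1) pk1 ps rk by blast
  then show ?thesis using assms(1,2) unfolding subcat_def by blast
qed

section \<open>From a twin cotorsion pair to the locale\<close>

definition exact :: "'o \<Rightarrow> 'm \<Rightarrow> 'o \<Rightarrow> 'm \<Rightarrow> 'o \<Rightarrow> bool" where
  "exact X f Y g Z \<longleftrightarrow> (\<exists>h. dist X f Y g Z h)"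

lemma star_eq_ext_star: "star C M N = ext_star C exact M N"
proof (rule set_eqI)
  fix Z
  have "(\<exists>f g h. (f,g,h) \<in> dtri C \<and> dm C f \<in> M \<and> cd C f = Z \<and> cd C g \<in> N) \<longleftrightarrow>
    (\<exists>A f g B. A \<in> M \<and> B \<in> N \<and> exact A f Z g B)" (is "?L \<longleftrightarrow> ?R")
  proof
    assume ?L
    then obtain f g h where f: "(f,g,h) \<in> dtri C" "dm C f \<in> M" "cd C f = Z" "cd C g \<in> N" by blast
    have "pretriangle C f g h" using dtri_pretriangle f(1) .
    then have "f \<in> Hom C (dm C f) Z" using f(3) by (simp add: pretriangle_def Hom_def)
    then show ?R using dtri_dist[OF f(1)] f unfolding exact_def by blast
  next
    assume ?R
    then obtain A f g B h where "A \<in> M" "B \<in> N" "dist A f Z g B h" unfolding exact_def by blast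
    then show ?L using distD HomD(2,3) by metis
  qed
  then show "Z \<in> star C M N \<longleftrightarrow> Z \<in> ext_star C exact M N"
    unfolding star_def ext_star_def by simp
qed

lemma ext1_zero_shift_up:
  assumes "ext1_zero C M N" "X \<in> M" "P \<in> shift_up C N" "f \<in> Hom C X P"
  shows "f = zr C X P"
proof -
  obtain Y c where Y: "Y \<in> N" "c \<in> Hom C (sho C Y) P" "iso C c"
    using assms(3) unfolding shift_up_def isomorphic_def by blast
  obtain b where b: "b \<in> Hom C P (sho C Y)" "c \<cdot> b = idm C P" using isoE[OF Y(3,2)] .
  have "b \<cdot> f = zr C X (sho C Y)"
    using assms(1,2) Y(1) b(1) assms(4) unfolding ext1_zero_def by blast
  then show ?thesis
    using comp_assoc[OF Y(2) b(1) assms(4)] b(2) assms(4) comp_zero[OF Y(2)] HomD(4)[OF assms(4)] by simp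
qed

lemma ext1_zero_shift_down:
  assumes "ext1_zero C M N" "Y \<in> N" "P \<in> shift_down C M" "f \<in> Hom C P Y"
  shows "f = zr C P Y"
proof -
  note o = HomD(4,5)[OF assms(4)]
  have "shm C f \<in> Hom C (sho C P) (sho C Y)" "sho C P \<in> M"
    using assms(3,4) by (auto simp: shift_down_def)
  then have "shm C f = shm C (zr C P Y)"
    using assms(1,2) shift_zero[OF o] unfolding ext1_zero_def by auto
  then show ?thesis using shift_faithful[OF assms(4) zero_Hom[OF o]] by simp
qed

text \<open>Decompose the shift of X as s -> X[1] -> t', replace the outer terms by isomorphic
  shifts of P and t, and unshift the whole triangle.\<close>

lemma cotorsion_decompose_down:
  assumes "cotorsion_pair C S T" "subcat C S" "subcat C T" "X \<in> obj C"
  shows "\<exists>P f g t. P \<in> shift_down C S \<and> t \<in> T \<and> exact P f X g t"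
proof -
  have "sho C X \<in> ext_star C exact S (shift_up C T)"
    using assms(1,4) unfolding cotorsion_pair_def star_eq_ext_star by auto
  then obtain s f g t' h where e: "s \<in> S" "t' \<in> shift_up C T" "dist s f (sho C X) g t' h"
    unfolding ext_star_def exact_def by blast
  note d = distD[OF e(3)]
  obtain P where P: "P \<in> obj C" "isomorphic C (sho C P) s" using shift_ess_surj[OF HomD(4)[OF d(2)]] .
  obtain a where a: "a \<in> Hom C (sho C P) s" "iso C a" using P(2) unfolding isomorphic_def by blast
  obtain a' where a': "a' \<in> Hom C s (sho C P)" "a' \<cdot> a = idm C (sho C P)" "a \<cdot> a' = idm C s" "iso C a'"
    using isoE[OF a(2,1)] .
  obtain t c where c: "t \<in> T" "c \<in> Hom C (sho C t) t'" "iso C c"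
    using e(2) unfolding shift_up_def isomorphic_def by blast
  obtain c' where c': "c' \<in> Hom C t' (sho C t)" "c' \<cdot> c = idm C (sho C t)" "c \<cdot> c' = idm C t'" "iso C c'"
    using isoE[OF c(3,2)] .
  have t: "t \<in> obj C" using c(1) assms(3) unfolding subcat_def by blast
  note X = HomD(5)[OF d(2)]
  let ?h = "(shm C a' \<cdot> h) \<cdot> c"
  have ha: "shm C a' \<cdot> h \<in> Hom C t' (sho C (sho C P))" using shift_Hom[OF a'(1)] d(4) by blast
  have fa: "f \<cdot> a \<in> Hom C (sho C P) (sho C X)" and cg: "c' \<cdot> g \<in> Hom C (sho C X) (sho C t)"
    and h: "?h \<in> Hom C (sho C t) (sho C (sho C P))"
    using d a(1) c'(1) ha c(2) by blast+
  have "dist (sho C P) (f \<cdot> a) (sho C X) (c' \<cdot> g) (sho C t) ?h"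
  proof (rule dist_iso[OF e(3) fa cg h a'(1) id_Hom[OF X] c'(1) a'(4) iso_id[OF X] c'(4)])
    show "f \<cdot> a \<cdot> a' = idm C (sho C X) \<cdot> f"
      using comp_assoc[OF d(2) a(1) a'(1)] a'(3) d(2) by simp
    show "c' \<cdot> g \<cdot> idm C (sho C X) = c' \<cdot> g" using cg by simp
    show "?h \<cdot> c' = shm C a' \<cdot> h" using comp_assoc[OF ha c(2) c'(1)] c'(3) ha by simp
  qed
  moreover obtain p where p: "p \<in> Hom C P X" "f \<cdot> a = shm C p" using shift_full[OF fa P(1) assms(4)] .
  moreover obtain r where r: "r \<in> Hom C X t" "c' \<cdot> g = shm C r" using shift_full[OF cg assms(4) t] .
  ultimately have "exact P p X r t" using dist_unshift unfolding exact_def by metis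
  moreover have "sho C P \<in> S"
    using isomorphic_sym[OF P(2)] e(1) assms(2) unfolding subcat_def by blast
  ultimately show ?thesis using c(1) P(1) unfolding shift_down_def by blast
qed

lemma twin_cotorsion_pair_twin_pair:
  assumes "subcat C S" "subcat C T" "subcat C U" "subcat C V" "twin_cotorsion_pair C S T U V"
  shows "twin_pair C exact (shift_down C S) S T U V (shift_up C V) (Wcal T U)"
proof -
  have obj: "S \<subseteq> obj C" "T \<subseteq> obj C" "U \<subseteq> obj C" "V \<subseteq> obj C"
    using assms(1-4) by (simp_all add: subcat_def)
  have ST: "cotorsion_pair C S T" and UV: "cotorsion_pair C U V" and SV: "ext1_zero C S V"
    using assms(5) by (simp_all add: twin_cotorsion_pair_def)
  have eST: "ext1_zero C S T" and eUV: "ext1_zero C U V"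
    using ST UV by (simp_all add: cotorsion_pair_def)
  note decST = cotorsion_decompose_down[OF ST assms(1,2)]
  have decUV: "\<exists>u f g P. u \<in> U \<and> P \<in> shift_up C V \<and> exact u f X g P" if "X \<in> obj C" for X
    using UV that unfolding cotorsion_pair_def star_eq_ext_star unfolding ext_star_def by blast
  \<comment> \<open>If all maps from S[-1] to X vanish, then in P -> X -> t the identity of X
    factors through t, so X is a retract of t. The equation for U is proved dually.\<close>
  have Teq: "T = {X \<in> obj C. \<forall>P\<in>shift_down C S. \<forall>f\<in>Hom C P X. f = zr C P X}" (is "_ = ?T")
  proof
    show "T \<subseteq> ?T" using obj ext1_zero_shift_down[OF eST] by blast
    show "?T \<subseteq> T"
    proof
      fix X assume X: "X \<in> ?T"
      then have Xo: "X \<in> obj C" by simp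
      obtain P f g t h where d: "P \<in> shift_down C S" "t \<in> T" "dist P f X g t h"
        using decST[OF Xo] unfolding exact_def by blast
      note dH = distD[OF d(3)]
      have "idm C X \<cdot> f = zr C P X" using X d(1) dH(2) by simp
      then obtain r where "r \<in> Hom C t X" "idm C X = r \<cdot> g"
        using dist_weak_cokernel[OF d(3) id_Hom[OF Xo]] by blast
      then show "X \<in> T" using subcat_retract[OF assms(2) d(2) dH(3)] by simp
    qed
  qed
  have Ueq: "U = {X \<in> obj C. \<forall>P\<in>shift_up C V. \<forall>f\<in>Hom C X P. f = zr C X P}" (is "_ = ?U")
  proof
    show "U \<subseteq> ?U" using obj ext1_zero_shift_up[OF eUV] by blast
    show "?U \<subseteq> U"
    proof
      fix X assume X: "X \<in> ?U"
      then have Xo: "X \<in> obj C" by simp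
      obtain u f g P h where d: "u \<in> U" "P \<in> shift_up C V" "dist u f X g P h"
        using decUV[OF Xo] unfolding exact_def by blast
      note dH = distD[OF d(3)]
      have "g \<cdot> idm C X = zr C X P" using X d(2) dH(3) by simp
      then obtain r where "r \<in> Hom C X u" "idm C X = f \<cdot> r"
        using dist_weak_kernel[OF d(3) id_Hom[OF Xo]] by blast
      then show "X \<in> U" using subcat_retract[OF assms(3) d(1) _ dH(2)] by simp
    qed
  qed
  \<comment> \<open>T and U may supply different zero objects; these are isomorphic, so either lies
    in the intersection.\<close>
  have Wz: "\<exists>Z\<in>Wcal T U. zero_obj C Z"
  proof -
    obtain Z N where Z: "Z \<in> T" "zero_obj C Z" and N: "N \<in> U" "zero_obj C N"
      using assms(2,3) unfolding subcat_def by blast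
    have o: "Z \<in> obj C" "N \<in> obj C" "idm C Z = zr C Z Z" "idm C N = zr C N N"
      using Z N by (auto simp: zero_obj_def)
    have "iso C (zr C N Z)"
      by (rule isoI[of _ N Z "zr C Z N"])
        (simp_all add: o comp_zero[OF zero_Hom])
    then have "isomorphic C N Z" unfolding isomorphic_def using o by blast
    then have "Z \<in> U" using N assms(3) unfolding subcat_def by blast
    then show ?thesis using Z by (auto simp: Wcal_def)
  qed
  have Ws: "B \<in> Wcal T U" if "X \<in> Wcal T U" "Y \<in> Wcal T U" "is_biprod C X Y B" for X Y B
    using that assms(2,3) unfolding Wcal_def subcat_def by blast
  show ?thesis
  proof (unfold_locales, goal_cases)
    case 1 then show ?case unfolding exact_def using distD by blast
  next case 2 then show ?case unfolding exact_def using dist_comp_zero by blast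
  next case 3 then show ?case unfolding exact_def using dist_weak_cokernel by blast
  next case 4 then show ?case unfolding exact_def using dist_weak_kernel by blast
  next case (5 f X Y) then show ?case unfolding exact_def using dist_cone[OF 5] by metis
  next case (6 g Y Z) then show ?case unfolding exact_def using dist_cocone[OF 6] by blast
  next case 7 then show ?case unfolding exact_def using dist_octahedron by metis
  next case 8 then show ?case unfolding exact_def using dist_octahedron' by blast
  next
    case (9 P j X m Y)
    then obtain h where "dist P j X m Y h" unfolding exact_def by blast
    from dist_rotate[OF this] 9(2) show ?case unfolding exact_def shift_down_def by blast
  next
    case (10 X m Y n s)
    then obtain h where h: "dist X m Y n s h" unfolding exact_def by blast
    obtain P where P: "P \<in> obj C" "isomorphic C (sho C P) s"
      using shift_ess_surj 10(2) obj(1) by blast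
    moreover have "sho C P \<in> S"
      using isomorphic_sym[OF P(2)] 10(2) assms(1) unfolding subcat_def by blast
    ultimately show ?case
      using dist_unrotate[OF h P(2,1)] unfolding exact_def shift_down_def by blast
  next
    case (11 Y m X j P)
    then obtain h where h: "dist Y m X j P h" unfolding exact_def by blast
    obtain v where v: "v \<in> V" "isomorphic C (sho C v) P" using 11(2) unfolding shift_up_def by blast
    then show ?case using dist_unrotate[OF h v(2)] obj(4) unfolding exact_def by blast
  next
    case (12 v n Y m X)
    then obtain h where h: "dist v n Y m X h" unfolding exact_def by blast
    have v: "sho C v \<in> obj C" using 12(2) obj(4) by blast
    then have "isomorphic C (sho C v) (sho C v)"
      unfolding isomorphic_def using iso_id[OF v] by blast
    then have "sho C v \<in> shift_up C V" using v 12(2) unfolding shift_up_def by blast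
    then show ?case using dist_rotate[OF h] unfolding exact_def by blast
  next case 13 then show ?case by (rule decST)
  next case 14 then show ?case by (rule decUV)
  next case 15 show ?case by (auto simp: shift_down_def)
  next case 16 show ?case by (auto simp: shift_up_def)
  next case 17 show ?case by (rule Teq)
  next case 18 show ?case by (rule Ueq)
  \<comment> \<open>Here and in the next case the twin condition Ext^1(S,V) = 0 enters.\<close>
  next case 19 show ?case by (subst Ueq) (use obj ext1_zero_shift_up[OF SV] in blast)
  next case 20 show ?case by (subst Teq) (use obj ext1_zero_shift_down[OF SV] in blast)
  next case 21 show ?case by (simp add: Wcal_def)
  next case 22 show ?case by (rule Wz)
  next case 23 then show ?case by (rule Ws)
  qed
qed

end

theorem theorem5p4:
  fixes C :: "('o,'m) tricat" and S T U V :: "'o set"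
  assumes "triangulated C"
    and "subcat C S" and "subcat C T" and "subcat C U" and "subcat C V"
    and "twin_cotorsion_pair C S T U V"
  shows "semi_abelian (Hquot C S T U V)"
proof -
  interpret tri_cat C by standard fact
  interpret twin_pair C exact "shift_down C S" S T U V "shift_up C V" "Wcal T U"
    by (rule twin_cotorsion_pair_twin_pair) fact+
  show ?thesis
    using semi_abelian_quot
    unfolding Hquot_def Hcal_def Cplus_def Cminus_def star_eq_ext_star .
qed

end
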